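(* Let $\mathcal{B}$ be the binary Boolean semiring. For every integer $n \geq 2$, the metric dimension of the zero-divisor graph $\Gamma(M_n(\mathcal{B}))$ equals $$\dim_M(\Gamma(M_n(\mathcal{B}))) = 2(n-1)+\sum_{\substack{0\le i,j\le n-2\\ (i,j)\neq(0,0)}}\binom{n}{i}\binom{n}{j}\left[\left(\sum_{k=0}^{n-j}(-1)^k\binom{n-j}{k}\left(2^{n-j-k}-1\right)^{n-i}\right)-1\right].$$
   Context: The binary Boolean semiring $\mathcal{B}$ is the set $\{0,1\}$ with addition and multiplication as in $\mathbb{Z}$ except that $1+1=1$. $M_n(\mathcal{B})$ is the semiring of $n\times n$ matrices over $\mathcal{B}$. For a semiring $T$, let $Z(T)=\{x\in T : \text{there exists } 0\neq y\in T \text{ with } xy=0 \text{ or } yx=0\}$. The zero-divisor graph $\Gamma(T)$ is the simple undirected graph with vertex set $Z(T)\setminus\{0\}$, in which distinct vertices $x,y$ are adjacent iff $xy=0$ or $yx=0$. The distance $d(x,y)$ is the length of a shortest path. A set $W=\{w_1,\dots,w_k\}$ of vertices of a graph $G$ is a resolving set for $G$ if distinct vertices $v$ of $G$ have distinct vectors $(d(v,w_1),\dots,d(v,w_k))$. The metric dimension $\dim_M(G)$ is the minimal cardinality of a resolving set for $G$. *)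

theory Defs
  imports
    "Jordan_Normal_Form.Matrix"
    "Graph_Theory.Pair_Digraph"
    "Graph_Theory.Shortest_Path"
begin

text \<open>
  A separate type is used because \<^typ>\<open>bool\<close> carries no semiring structure, and the matrix
  product is built from the type-class operations of the entries.
\<close>

datatype boolean_semiring = BZero | BOne

instantiation boolean_semiring :: comm_semiring_1
begin

definition zero_boolean_semiring :: boolean_semiring where "0 = BZero"
definition one_boolean_semiring :: boolean_semiring where "1 = BOne"

fun plus_boolean_semiring :: "boolean_semiring \<Rightarrow> boolean_semiring \<Rightarrow> boolean_semiring" where
  "BZero + BZero = BZero"
| "BZero + BOne = BOne"
| "BOne + BZero = BOne"
| "BOne + BOne = BOne"

fun times_boolean_semiring :: "boolean_semiring \<Rightarrow> boolean_semiring \<Rightarrow> boolean_semiring" where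
  "BZero * BZero = BZero"
| "BZero * BOne = BZero"
| "BOne * BZero = BZero"
| "BOne * BOne = BOne"

instance
proof
  fix a b c :: boolean_semiring
  show "a + b + c = a + (b + c)" by (cases a; cases b; cases c) simp_all
  show "a + b = b + a" by (cases a; cases b) simp_all
  show "0 + a = a" by (cases a) (simp_all add: zero_boolean_semiring_def)
  show "a * b * c = a * (b * c)" by (cases a; cases b; cases c) simp_all
  show "a * b = b * a" by (cases a; cases b) simp_all
  show "1 * a = a" by (cases a) (simp_all add: one_boolean_semiring_def)
  show "(a + b) * c = a * c + b * c" by (cases a; cases b; cases c) simp_all
  show "0 * a = 0" by (cases a) (simp_all add: zero_boolean_semiring_def)
  show "a * 0 = 0" by (cases a) (simp_all add: zero_boolean_semiring_def)
  show "(0 :: boolean_semiring) \<noteq> 1"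
    by (simp add: zero_boolean_semiring_def one_boolean_semiring_def)
qed

end

abbreviation boolean_matrices :: "nat \<Rightarrow> boolean_semiring mat ring" where
  "boolean_matrices n \<equiv> ring_mat TYPE(boolean_semiring) n ()"

text \<open>
  The record type \<^typ>\<open>'a ring\<close> only provides the signature; the definitions below are meant for
  structures satisfying \<^const>\<open>semiring\<close>, which \<^term>\<open>boolean_matrices n\<close> does.
\<close>

lemma semiring_boolean_matrices: "semiring (boolean_matrices n)"
  by (rule semiring_mat)

definition zero_divisors :: "('a, 'b) ring_scheme \<Rightarrow> 'a set" where
  "zero_divisors T = {x \<in> carrier T. \<exists>y \<in> carrier T. y \<noteq> \<zero>\<^bsub>T\<^esub> \<and>
     (x \<otimes>\<^bsub>T\<^esub> y = \<zero>\<^bsub>T\<^esub> \<or> y \<otimes>\<^bsub>T\<^esub> x = \<zero>\<^bsub>T\<^esub>)}"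

text \<open>
  A simple undirected graph is represented as a loop-free digraph without parallel arcs whose
  arc relation is symmetric: an edge between \<open>x\<close> and \<open>y\<close> is the pair of arcs \<open>(x, y)\<close>, \<open>(y, x)\<close>.
\<close>

definition zero_divisor_graph :: "('a, 'b) ring_scheme \<Rightarrow> 'a pair_pre_digraph" where
  "zero_divisor_graph T =
    (let V = zero_divisors T - {\<zero>\<^bsub>T\<^esub>} in
      \<lparr> pverts = V,
        parcs = {(x, y). x \<in> V \<and> y \<in> V \<and> x \<noteq> y \<and>
          (x \<otimes>\<^bsub>T\<^esub> y = \<zero>\<^bsub>T\<^esub> \<or> y \<otimes>\<^bsub>T\<^esub> x = \<zero>\<^bsub>T\<^esub>)} \<rparr>)"

lemma zero_divisor_graph_simple:
  "pair_sym_digraph (zero_divisor_graph T)" "pair_loopfree_digraph (zero_divisor_graph T)"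
  by (unfold_locales; auto simp: zero_divisor_graph_def Let_def symmetric_def sym_def)+

text \<open>
  With unit weights, \<open>wf_digraph.\<mu>\<close> is the least number of arcs of a walk from \<open>u\<close> to \<open>v\<close>,
  and \<open>\<infinity>\<close> if there is no such walk.
\<close>

definition graph_dist :: "'a pair_pre_digraph \<Rightarrow> 'a \<Rightarrow> 'a \<Rightarrow> ereal" where
  "graph_dist G u v = wf_digraph.\<mu> (with_proj G) (\<lambda>_. 1) u v"

definition resolving_set :: "'a pair_pre_digraph \<Rightarrow> 'a set \<Rightarrow> bool" where
  "resolving_set G W \<longleftrightarrow> finite W \<and> W \<subseteq> pverts G \<and>
     (\<forall>u \<in> pverts G. \<forall>v \<in> pverts G.
        (\<forall>w \<in> W. graph_dist G u w = graph_dist G v w) \<longrightarrow> u = v)"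

text \<open>
  The infimum is over sets of natural numbers, so it is an attained minimum as soon as there is a
  resolving set; in a finite graph the set of all vertices is one.
\<close>

definition metric_dimension :: "'a pair_pre_digraph \<Rightarrow> nat" where
  "metric_dimension G = (INF W \<in> {W. resolving_set G W}. card W)"

lemma resolving_set_pverts:
  assumes "pair_wf_digraph G" "finite (pverts G)"
  shows "resolving_set G (pverts G)"
proof -
  interpret pair_wf_digraph G by fact
  have 1: "\<mu> (\<lambda>_. 1) u u \<le> 0" if "u \<in> pverts G" for u
    using min_cost_le_walk_cost[of u "[]" u "\<lambda>_. 1"] that
    by (simp add: awalk_Nil_iff awalk_cost_def zero_ereal_def)
  have 2: "\<mu> (\<lambda>_. 1) v u \<ge> 1" if "u \<noteq> v" for u v
    unfolding \<mu>_def
  proof (rule INF_greatest, clarsimp)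
    fix p assume "awalk v p u"
    then have "p \<noteq> []" using that by (auto simp: awalk_def)
    then show "1 \<le> awalk_cost (\<lambda>_. 1) p"
      by (cases p) (auto simp: awalk_cost_def sum_list_triv)
  qed
  have "u = v" if "u \<in> pverts G" "graph_dist G u u = graph_dist G v u" for u v
  proof (rule ccontr)
    assume "u \<noteq> v"
    then have "(1::ereal) \<le> 0"
      using 1[OF that(1)] 2[of u v] that(2) unfolding graph_dist_def by (metis order_trans)
    then show False by simp
  qed
  then show ?thesis using assms(2) by (auto simp: resolving_set_def)
qed

end

(* Whether a product vanishes, hence every distance, depends only on the pattern of a matrix: its zero
   rows and its zero columns.  Matrices with the same pattern are twins, so a resolving set W omits at
   most one matrix of each pattern, and |W| = #vertices - #patterns + #F, where F is the set of the
   patterns all of whose matrices lie in W.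

   Upper bound: 2(n - 1) patterns suffice for F, namely those with a single nonzero row a < n - 1 and no
   zero column, and their transposes; each of them belongs to exactly one matrix.

   Lower bound for n >= 3: let x (resp. y) count the a such that F contains a pattern whose only nonzero
   row (resp. column) is a and which has at least two nonzero columns (resp. rows), and let z count the
   matrix units in F.  The patterns with zero rows {..<n} - {r} and zero column a can be told apart only
   by matrices whose only nonzero row is a.  This gives z >= (n - x)(n - x - 1), and z >= (n - y)(n - y - 1)
   by transposition, whence x + y + z >= 2(n - 1).  For n = 2 there are 8 patterns but only
   3 positive distances. *)

theory Submission
  imports Defs
begin

section \<open>Zero patterns of Boolean matrices\<close>

definition zero_rows :: "'a::zero mat \<Rightarrow> nat set" where
  "zero_rows A = {i. i < dim_row A \<and> (\<forall>j < dim_col A. A $$ (i, j) = 0)}"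

definition zero_cols :: "'a::zero mat \<Rightarrow> nat set" where
  "zero_cols A = {j. j < dim_col A \<and> (\<forall>i < dim_row A. A $$ (i, j) = 0)}"

definition pattern :: "'a::zero mat \<Rightarrow> nat set \<times> nat set" where
  "pattern A = (zero_rows A, zero_cols A)"

text \<open>Only the zero matrix has all rows or all columns zero, and a matrix with no zero row and
  no zero column has no nonzero annihilator; what remains are the patterns of the vertices.\<close>

definition patterns :: "nat \<Rightarrow> (nat set \<times> nat set) set" where
  "patterns n = {(R, C). R \<subset> {..<n} \<and> C \<subset> {..<n} \<and> (R, C) \<noteq> ({}, {})}"

lemma patterns_iff: "c \<in> patterns n \<longleftrightarrow> fst c \<subset> {..<n} \<and> snd c \<subset> {..<n} \<and> c \<noteq> ({}, {})"
  by (cases c) (simp add: patterns_def)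

text \<open>On patterns, this says that one of the two products of the matrices vanishes. It may
  hold for \<open>c = d\<close>, as distinct twins can annihilate each other.\<close>

definition adj :: "nat \<Rightarrow> nat set \<times> nat set \<Rightarrow> nat set \<times> nat set \<Rightarrow> bool" where
  "adj n c d \<longleftrightarrow> snd c \<union> fst d = {..<n} \<or> snd d \<union> fst c = {..<n}"

text \<open>For members of \<open>patterns n\<close> this is the exact obstruction to a common
  neighbour, see \<open>common_neighbour\<close>.\<close>

definition far :: "nat set \<times> nat set \<Rightarrow> nat set \<times> nat set \<Rightarrow> bool" where
  "far c d \<longleftrightarrow> fst c = {} \<and> fst d = {} \<and> snd c \<inter> snd d = {} \<or>
     snd c = {} \<and> snd d = {} \<and> fst c \<inter> fst d = {}"

text \<open>The distance between two \<^emph>\<open>distinct\<close> vertices with patterns \<open>c\<close> and \<open>d\<close>.\<close>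

definition pdist :: "nat \<Rightarrow> nat set \<times> nat set \<Rightarrow> nat set \<times> nat set \<Rightarrow> nat" where
  "pdist n c d = (if adj n c d then 1 else if far c d then 3 else 2)"

lemma boolean_add_eq_0_iff: "a + b = 0 \<longleftrightarrow> a = 0 \<and> b = (0 :: boolean_semiring)"
  by (cases a; cases b) (auto simp: zero_boolean_semiring_def)

lemma boolean_mult_eq_0_iff: "a * b = 0 \<longleftrightarrow> a = 0 \<or> b = (0 :: boolean_semiring)"
  by (cases a; cases b) (auto simp: zero_boolean_semiring_def)

lemma boolean_sum_eq_0_iff:
  "finite I \<Longrightarrow> sum f I = 0 \<longleftrightarrow> (\<forall>i\<in>I. f i = (0 :: boolean_semiring))"
  by (induction I rule: finite_induct) (auto simp: boolean_add_eq_0_iff)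

lemma boolean_neq_0_iff: "a \<noteq> 0 \<longleftrightarrow> a = (1 :: boolean_semiring)"
  by (cases a) (auto simp: zero_boolean_semiring_def one_boolean_semiring_def)

text \<open>Boolean sums cannot cancel and a product of entries vanishes only with one of its
  factors, so every inner index must be a zero column of \<open>A\<close> or a zero row of
  \<open>B\<close>.\<close>

lemma boolean_mat_mult_eq_0_iff:
  fixes A B :: "boolean_semiring mat"
  assumes "A \<in> carrier_mat n n" "B \<in> carrier_mat n n"
  shows "A * B = 0\<^sub>m n n \<longleftrightarrow> zero_cols A \<union> zero_rows B = {..<n}"
proof -
  have "A * B = 0\<^sub>m n n \<longleftrightarrow> (\<forall>i<n. \<forall>j<n. \<forall>k<n. A $$ (i, k) = 0 \<or> B $$ (k, j) = 0)"
    using assms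
    by (simp add: mat_eq_iff scalar_prod_def boolean_sum_eq_0_iff boolean_mult_eq_0_iff Ball_def)
  also have "\<dots> \<longleftrightarrow> (\<forall>k<n. (\<forall>i<n. A $$ (i, k) = 0) \<or> (\<forall>j<n. B $$ (k, j) = 0))"
    by blast
  also have "\<dots> \<longleftrightarrow> zero_cols A \<union> zero_rows B = {..<n}"
    using assms by (auto simp: zero_cols_def zero_rows_def)
  finally show ?thesis .
qed

text \<open>For proper subsets of \<open>{..<n}\<close> this is the entrywise largest matrix with
  the prescribed zero rows and columns.\<close>

definition pattern_mat :: "nat \<Rightarrow> nat set \<times> nat set \<Rightarrow> boolean_semiring mat" where
  "pattern_mat n c = mat n n (\<lambda>(i, j). if i \<in> fst c \<or> j \<in> snd c then 0 else 1)"

lemma pattern_mat_carrier [simp]: "pattern_mat n c \<in> carrier_mat n n"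
  by (simp add: pattern_mat_def)

text \<open>An index outside \<open>C\<close> makes every row outside \<open>R\<close> nonzero, and
  an index outside \<open>R\<close> does the same for the columns; hence both inclusions must be
  proper.\<close>

lemma pattern_pattern_mat:
  assumes "R \<subset> {..<n}" "C \<subset> {..<n}"
  shows "pattern (pattern_mat n (R, C)) = (R, C)"
proof -
  obtain i j where "i < n" "i \<notin> R" "j < n" "j \<notin> C" using assms by blast
  then have "(\<forall>j<n. j \<in> C) \<longleftrightarrow> False" "(\<forall>i<n. i \<in> R) \<longleftrightarrow> False" by auto
  moreover have "(if P then 0 else 1) = (0 :: boolean_semiring) \<longleftrightarrow> P" for P by simp
  ultimately show ?thesis using assms
    by (auto simp: pattern_def pattern_mat_def zero_rows_def zero_cols_def)
qed

lemma zero_rows_subset: "A \<in> carrier_mat n n \<Longrightarrow> zero_rows A \<subseteq> {..<n}"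
  and zero_cols_subset: "A \<in> carrier_mat n n \<Longrightarrow> zero_cols A \<subseteq> {..<n}"
  by (auto simp: zero_rows_def zero_cols_def)

lemma zero_rows_eq_iff: "A \<in> carrier_mat n n \<Longrightarrow> zero_rows A = {..<n} \<longleftrightarrow> A = 0\<^sub>m n n"
  and zero_cols_eq_iff: "A \<in> carrier_mat n n \<Longrightarrow> zero_cols A = {..<n} \<longleftrightarrow> A = 0\<^sub>m n n"
  by (auto simp: zero_rows_def zero_cols_def mat_eq_iff set_eq_iff)

section \<open>Vertices and arcs of the graph in terms of patterns\<close>

abbreviation zdg :: "nat \<Rightarrow> boolean_semiring mat pair_pre_digraph" where
  "zdg n \<equiv> zero_divisor_graph (boolean_matrices n)"

text \<open>A nonempty set of zero rows is annihilated from the left by a matrix supported on the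
  columns with these indices, and dually for zero columns. Conversely, the lines of a nonzero
  annihilator alone never cover all indices.\<close>

lemma pverts_zdg: "pverts (zdg n) = {A \<in> carrier_mat n n. pattern A \<in> patterns n}"
proof -
  have "(\<exists>B \<in> carrier_mat n n. B \<noteq> 0\<^sub>m n n \<and> (A * B = 0\<^sub>m n n \<or> B * A = 0\<^sub>m n n)) \<and> A \<noteq> 0\<^sub>m n n
    \<longleftrightarrow> pattern A \<in> patterns n" if A: "A \<in> carrier_mat n n" for A :: "boolean_semiring mat"
  proof
    assume "pattern A \<in> patterns n"
    then have *: "zero_rows A \<subset> {..<n}" "zero_cols A \<subset> {..<n}"
      and **: "zero_rows A \<noteq> {} \<or> zero_cols A \<noteq> {}"
      by (auto simp: patterns_def pattern_def)
    have "A \<noteq> 0\<^sub>m n n" using * zero_rows_eq_iff[OF A] by auto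
    moreover have "\<exists>B \<in> carrier_mat n n. B \<noteq> 0\<^sub>m n n \<and> (A * B = 0\<^sub>m n n \<or> B * A = 0\<^sub>m n n)"
      using **
    proof
      assume ne: "zero_rows A \<noteq> {}"
      \<comment> \<open>The zero columns of \<open>?B\<close> complement the zero rows of
        \<open>A\<close>; since \<open>A\<close> has a zero row, they are not all columns, so
        \<open>?B\<close> is nonzero.\<close>
      let ?B = "pattern_mat n ({}, {..<n} - zero_rows A)"
      have "pattern ?B = ({}, {..<n} - zero_rows A)"
        using * ne by (intro pattern_pattern_mat) auto
      then have "?B * A = 0\<^sub>m n n" "?B \<noteq> 0\<^sub>m n n"
        using * ne A zero_cols_eq_iff[of ?B n] boolean_mat_mult_eq_0_iff[of ?B n A]
        by (auto simp: pattern_def)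
      then show ?thesis by (intro bexI[of _ ?B]) auto
    next
      assume ne: "zero_cols A \<noteq> {}"
      let ?B = "pattern_mat n ({..<n} - zero_cols A, {})"
      have "pattern ?B = ({..<n} - zero_cols A, {})"
        using * ne by (intro pattern_pattern_mat) auto
      then have "A * ?B = 0\<^sub>m n n" "?B \<noteq> 0\<^sub>m n n"
        using * ne A zero_rows_eq_iff[of ?B n] boolean_mat_mult_eq_0_iff[of A n ?B]
        by (auto simp: pattern_def)
      then show ?thesis by (intro bexI[of _ ?B]) auto
    qed
    ultimately show "(\<exists>B \<in> carrier_mat n n. B \<noteq> 0\<^sub>m n n \<and> (A * B = 0\<^sub>m n n \<or> B * A = 0\<^sub>m n n)) \<and> A \<noteq> 0\<^sub>m n n"
      by blast
  next
    assume "(\<exists>B \<in> carrier_mat n n. B \<noteq> 0\<^sub>m n n \<and> (A * B = 0\<^sub>m n n \<or> B * A = 0\<^sub>m n n)) \<and> A \<noteq> 0\<^sub>m n n"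
    then obtain B where B: "B \<in> carrier_mat n n" "B \<noteq> 0\<^sub>m n n" "A * B = 0\<^sub>m n n \<or> B * A = 0\<^sub>m n n"
      and nz: "A \<noteq> 0\<^sub>m n n" by auto
    have "zero_cols A \<union> zero_rows B = {..<n} \<or> zero_cols B \<union> zero_rows A = {..<n}"
      using B(3) boolean_mat_mult_eq_0_iff[OF A B(1)] boolean_mat_mult_eq_0_iff[OF B(1) A] by blast
    moreover have "zero_rows B \<noteq> {..<n}" "zero_cols B \<noteq> {..<n}"
      using B(2) zero_rows_eq_iff[OF B(1)] zero_cols_eq_iff[OF B(1)] by blast+
    ultimately have "zero_cols A \<noteq> {} \<or> zero_rows A \<noteq> {}" by blast
    moreover have "zero_rows A \<subset> {..<n}" "zero_cols A \<subset> {..<n}"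
      using nz zero_rows_eq_iff[OF A] zero_cols_eq_iff[OF A] zero_rows_subset[OF A]
        zero_cols_subset[OF A] by auto
    ultimately show "pattern A \<in> patterns n" by (auto simp: patterns_def pattern_def)
  qed
  then show ?thesis
    by (auto simp: zero_divisor_graph_def Let_def zero_divisors_def ring_mat_simps)
qed

lemma parcs_zdg:
  "(A, B) \<in> parcs (zdg n) \<longleftrightarrow>
    A \<in> pverts (zdg n) \<and> B \<in> pverts (zdg n) \<and> A \<noteq> B \<and> adj n (pattern A) (pattern B)"
proof -
  have "A * B = 0\<^sub>m n n \<or> B * A = 0\<^sub>m n n \<longleftrightarrow> adj n (pattern A) (pattern B)"
    if "A \<in> pverts (zdg n)" "B \<in> pverts (zdg n)"
    using that boolean_mat_mult_eq_0_iff[of A n B] boolean_mat_mult_eq_0_iff[of B n A]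
    by (simp add: pverts_zdg adj_def pattern_def)
  then show ?thesis
    by (auto simp: zero_divisor_graph_def Let_def ring_mat_simps)
qed

lemma finite_pverts_zdg: "finite (pverts (zdg n))"
proof -
  have "(carrier_mat n n :: boolean_semiring mat set) \<subseteq> (\<lambda>f. mat n n f) ` (({..<n} \<times> {..<n}) \<rightarrow>\<^sub>E UNIV)"
  proof
    fix A :: "boolean_semiring mat" assume "A \<in> carrier_mat n n"
    then have "A = mat n n (restrict (\<lambda>(i,j). A $$ (i, j)) ({..<n} \<times> {..<n}))"
      by (auto simp: mat_eq_iff)
    then show "A \<in> (\<lambda>f. mat n n f) ` (({..<n} \<times> {..<n}) \<rightarrow>\<^sub>E UNIV)"
      by (simp add: image_iff) (rule bexI[where x = "\<lambda>(i,j)\<in>{..<n} \<times> {..<n}. A $$ (i, j)"], auto)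
  qed
  moreover have "(UNIV :: boolean_semiring set) = {BZero, BOne}"
    using boolean_semiring.exhaust by auto
  then have "finite (UNIV :: boolean_semiring set)"
    by (metis finite.emptyI finite_insert)
  ultimately have "finite (carrier_mat n n :: boolean_semiring mat set)"
    by (meson finite_PiE finite_SigmaI finite_imageI finite_lessThan finite_subset)
  then show ?thesis by (simp add: pverts_zdg)
qed

text \<open>Lifts neighbours and paths of patterns to the graph.\<close>

lemma pattern_surj: "c \<in> patterns n \<Longrightarrow> \<exists>A \<in> pverts (zdg n). pattern A = c"
  by (cases c, rule bexI[of _ "pattern_mat n c"])
    (auto simp: pverts_zdg patterns_def pattern_pattern_mat)

section \<open>Distances\<close>

text \<open>Transposing matrices swaps zero rows and zero columns and reverses products. This
  symmetry reduces statements on columns to statements on rows.\<close>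

lemma adj_swap [simp]: "adj n (prod.swap c) (prod.swap d) \<longleftrightarrow> adj n c d"
  and far_swap [simp]: "far (prod.swap c) (prod.swap d) \<longleftrightarrow> far c d"
  and pdist_swap [simp]: "pdist n (prod.swap c) (prod.swap d) = pdist n c d"
  and patterns_swap [simp]: "prod.swap c \<in> patterns n \<longleftrightarrow> c \<in> patterns n"
  by (auto simp: adj_def far_def pdist_def patterns_def Un_commute Int_commute split: prod.splits)

text \<open>A common neighbour on the same side of both matrices requires a shared zero column or a
  shared zero row; one between them requires a zero column of one and a zero row of the other. All
  of this fails exactly when \<open>far c d\<close> holds.\<close>

lemma common_neighbour:
  assumes "c \<in> patterns n" "d \<in> patterns n"
  shows "(\<exists>e \<in> patterns n. adj n c e \<and> adj n e d) \<longleftrightarrow> \<not> far c d"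
proof -
  obtain R C R' C' where cd: "c = (R, C)" "d = (R', C')" by (metis surj_pair)
  have sub: "R \<subset> {..<n}" "C \<subset> {..<n}" "R' \<subset> {..<n}" "C' \<subset> {..<n}"
    "R \<noteq> {} \<or> C \<noteq> {}" "R' \<noteq> {} \<or> C' \<noteq> {}"
    using assms by (auto simp: patterns_def cd)
  show ?thesis
  proof
    assume "\<exists>e \<in> patterns n. adj n c e \<and> adj n e d"
    then obtain S D where "(S, D) \<in> patterns n" "adj n c (S, D)" "adj n (S, D) d" by auto
    then have "S \<noteq> {..<n}" "D \<noteq> {..<n}" "C \<union> S = {..<n} \<or> D \<union> R = {..<n}"
      "C' \<union> S = {..<n} \<or> D \<union> R' = {..<n}"
      by (auto simp: patterns_def adj_def cd)
    then show "\<not> far c d" unfolding far_def cd fst_conv snd_conv by blast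
  next
    assume nf: "\<not> far c d"
    \<comment> \<open>The cases are the positions of the neighbour: to the right of both, to the
      left of both, right of \<open>c\<close> and left of \<open>d\<close>, right of
      \<open>d\<close> and left of \<open>c\<close>.\<close>
    consider "C \<inter> C' \<noteq> {}" | "R \<inter> R' \<noteq> {}" | "C \<noteq> {}" "R' \<noteq> {}" | "R \<noteq> {}" "C' \<noteq> {}"
      using nf sub by (auto simp: far_def cd)
    then show "\<exists>e \<in> patterns n. adj n c e \<and> adj n e d"
    proof cases
      case 1
      then show ?thesis using sub
        by (intro bexI[of _ "({..<n} - C \<inter> C', {})"]) (auto simp: patterns_def adj_def cd)
    next
      case 2
      then show ?thesis using sub
        by (intro bexI[of _ "({}, {..<n} - R \<inter> R')"]) (auto simp: patterns_def adj_def cd)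
    next
      case 3
      then show ?thesis using sub
        by (intro bexI[of _ "({..<n} - C, {..<n} - R')"]) (auto simp: patterns_def adj_def cd)
    next
      case 4
      then show ?thesis using sub
        by (intro bexI[of _ "({..<n} - C', {..<n} - R)"]) (auto simp: patterns_def adj_def cd)
    qed
  qed
qed

text \<open>Together with \<open>common_neighbour\<close> this bounds all distances by 3. Far
  patterns both lack zero rows or both lack zero columns; the second case is the transpose of the
  first.\<close>

lemma far_path:
  assumes "c \<in> patterns n" "d \<in> patterns n" "far c d"
  shows "\<exists>e \<in> patterns n. \<exists>f \<in> patterns n. adj n c e \<and> adj n e f \<and> adj n f d"
proof -
  have *: "\<exists>e \<in> patterns n. \<exists>f \<in> patterns n. adj n c e \<and> adj n e f \<and> adj n f d"
    if "c \<in> patterns n" "d \<in> patterns n" "fst c = {}" "fst d = {}" for c d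
  proof -
    \<comment> \<open>\<open>?e\<close> annihilates \<open>c\<close> from the right, and
      \<open>?f\<close> annihilates \<open>d\<close> from the right. The zero columns of
      \<open>c\<close> are built into \<open>?f\<close> so that the product of \<open>?f\<close> and
      \<open>?e\<close> vanishes as well.\<close>
    let ?e = "({..<n} - snd c, {})" and ?f = "({..<n} - snd d, snd c)"
    have "?e \<in> patterns n" "?f \<in> patterns n" "adj n c ?e" "adj n ?e ?f" "adj n ?f d"
      using that by (auto simp: patterns_def adj_def)
    then show ?thesis by blast
  qed
  consider "fst c = {}" "fst d = {}" | "snd c = {}" "snd d = {}"
    using assms(3) by (auto simp: far_def)
  then show ?thesis
  proof cases
    case 1
    then show ?thesis using assms * by blast
  next
    case 2
    then have "\<exists>e \<in> patterns n. \<exists>f \<in> patterns n.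
        adj n (prod.swap c) e \<and> adj n e f \<and> adj n f (prod.swap d)"
      using assms by (intro *) auto
    then obtain e f where "e \<in> patterns n" "f \<in> patterns n"
      "adj n (prod.swap c) e" "adj n e f" "adj n f (prod.swap d)" by blast
    then have "prod.swap e \<in> patterns n" "prod.swap f \<in> patterns n"
      "adj n c (prod.swap e)" "adj n (prod.swap e) (prod.swap f)" "adj n (prod.swap f) d"
      by (metis adj_swap patterns_swap swap_swap)+
    then show ?thesis by blast
  qed
qed

text \<open>Unit weights turn the cost of a walk into its length, so a shortest walk attains the
  infimum.\<close>

lemma graph_dist_eqI:
  assumes "pair_wf_digraph G" and "pre_digraph.awalk (with_proj G) u p v"
    and "\<And>q. pre_digraph.awalk (with_proj G) u q v \<Longrightarrow> length p \<le> length q"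
  shows "graph_dist G u v = real (length p)"
proof -
  interpret pair_wf_digraph G by fact
  have cost: "awalk_cost (\<lambda>_. 1) q = real (length q)" for q :: "('a \<times> 'a) list"
    by (simp add: awalk_cost_def sum_list_triv)
  show ?thesis
    unfolding graph_dist_def \<mu>_def cost
    using assms(2,3) by (intro INF_eqI) auto
qed

text \<open>Walks project to sequences of adjacent patterns, which gives the lower bounds; the upper
  bounds lift pattern paths to vertices. The formula includes distinct vertices with equal
  patterns.\<close>

lemma graph_dist_zdg:
  assumes u: "u \<in> pverts (zdg n)" and v: "v \<in> pverts (zdg n)"
  shows "graph_dist (zdg n) u v = real (if u = v then 0 else pdist n (pattern u) (pattern v))"
proof -
  have wf: "pair_wf_digraph (zdg n)"
    using zero_divisor_graph_simple(2) by (rule pair_loopfree_digraph.axioms(1))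
  interpret pair_wf_digraph "zdg n" by fact
  have pat: "pattern u \<in> patterns n" "pattern v \<in> patterns n"
    using u v by (auto simp: pverts_zdg)
  have len1: "length q > 0" if "awalk u q v" "u \<noteq> v" for q
    using that by (auto simp: awalk_Nil_iff)
  have len2: "length q > 1" if "awalk u q v" "u \<noteq> v" "\<not> adj n (pattern u) (pattern v)" for q
    using that by (cases q) (auto simp: awalk_simps parcs_zdg)
  have len3: "length q > 2" if q: "awalk u q v" and "u \<noteq> v" "\<not> adj n (pattern u) (pattern v)"
    "far (pattern u) (pattern v)" for q
  proof (rule ccontr)
    assume "\<not> length q > 2"
    then have "length q = 2" using len2[OF that(1,2,3)] by simp
    then obtain e f where "q = [e, f]" by (auto simp: length_Suc_conv numeral_2_eq_2)
    then obtain z where "(u, z) \<in> parcs (zdg n)" "(z, v) \<in> parcs (zdg n)"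
      using q by (cases e; cases f) (auto simp: awalk_simps)
    then have "pattern z \<in> patterns n" "adj n (pattern u) (pattern z)" "adj n (pattern z) (pattern v)"
      by (auto simp: parcs_zdg pverts_zdg)
    then show False using common_neighbour[OF pat] that(4) by blast
  qed
  consider "u = v" | "u \<noteq> v" "adj n (pattern u) (pattern v)"
    | "u \<noteq> v" "\<not> adj n (pattern u) (pattern v)" "\<not> far (pattern u) (pattern v)"
    | "u \<noteq> v" "\<not> adj n (pattern u) (pattern v)" "far (pattern u) (pattern v)"
    by blast
  then show ?thesis
  proof cases
    case 1
    then show ?thesis using graph_dist_eqI[OF wf, of u "[]" v] u by (simp add: awalk_Nil_iff)
  next
    case 2
    have "graph_dist (zdg n) u v = real (length [(u, v)])"
      using 2 u v len1 by (intro graph_dist_eqI[OF wf]) (auto simp: awalk_simps parcs_zdg Suc_leI)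
    then show ?thesis using 2 by (simp add: pdist_def)
  next
    case 3
    then obtain e where e: "e \<in> patterns n" "adj n (pattern u) e" "adj n e (pattern v)"
      using common_neighbour[OF pat] by blast
    then obtain z where z: "z \<in> pverts (zdg n)" "pattern z = e" using pattern_surj by blast
    \<comment> \<open>A coincidence would make the patterns of \<open>u\<close> and \<open>v\<close>
      adjacent.\<close>
    have "u \<noteq> z" "z \<noteq> v" using e z 3 by auto
    have "graph_dist (zdg n) u v = real (length [(u, z), (z, v)])"
    proof (rule graph_dist_eqI[OF wf])
      show "awalk u [(u, z), (z, v)] v"
        using u v z e \<open>u \<noteq> z\<close> \<open>z \<noteq> v\<close> by (auto simp: awalk_simps parcs_zdg)
      show "length [(u, z), (z, v)] \<le> length q" if "awalk u q v" for q
        using len2[OF that] 3 by simp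
    qed
    then show ?thesis using 3 by (simp add: pdist_def)
  next
    case 4
    then obtain e f where ef: "e \<in> patterns n" "f \<in> patterns n"
      "adj n (pattern u) e" "adj n e f" "adj n f (pattern v)"
      using far_path[OF pat] by blast
    then obtain y z where y: "y \<in> pverts (zdg n)" "pattern y = e"
      and z: "z \<in> pverts (zdg n)" "pattern z = f" using pattern_surj by blast
    have no: "\<not> (adj n (pattern u) g \<and> adj n g (pattern v))" if "g \<in> patterns n" for g
      using common_neighbour[OF pat] 4 that by blast
    \<comment> \<open>Any coincidence would turn \<open>e\<close> or \<open>f\<close> into a common
      neighbour, which \<open>no\<close> forbids.\<close>
    have "u \<noteq> y" "y \<noteq> z" "z \<noteq> v"
      using ef y z no[of "pattern y"] no[of "pattern z"] by metis+
    have "graph_dist (zdg n) u v = real (length [(u, y), (y, z), (z, v)])"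
    proof (rule graph_dist_eqI[OF wf])
      show "awalk u [(u, y), (y, z), (z, v)] v"
        using u v y z ef \<open>u \<noteq> y\<close> \<open>y \<noteq> z\<close> \<open>z \<noteq> v\<close> by (auto simp: awalk_simps parcs_zdg)
      show "length [(u, y), (y, z), (z, v)] \<le> length q" if "awalk u q v" for q
        using len3[OF that] 4 by simp
    qed
    then show ?thesis using 4 by (simp add: pdist_def)
  qed
qed

text \<open>A member of \<open>W\<close> is identified by its distance 0 to itself, so only pairs
  outside \<open>W\<close> matter, and there distances depend on patterns alone. In particular
  \<open>W\<close> misses at most one vertex of each pattern.\<close>

lemma resolving_set_zdg_iff:
  "resolving_set (zdg n) W \<longleftrightarrow> W \<subseteq> pverts (zdg n) \<and>
     (\<forall>u \<in> pverts (zdg n) - W. \<forall>v \<in> pverts (zdg n) - W. u \<noteq> v \<longrightarrow>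
       (\<exists>w \<in> W. pdist n (pattern u) (pattern w) \<noteq> pdist n (pattern v) (pattern w)))"
  (is "_ \<longleftrightarrow> _ \<and> ?sep")
proof (cases "W \<subseteq> pverts (zdg n)")
  case True
  let ?V = "pverts (zdg n)"
  let ?d = "\<lambda>u w. if u = w then 0 else pdist n (pattern u) (pattern w)"
  have pos: "pdist n c d > 0" for c d by (simp add: pdist_def)
  have "resolving_set (zdg n) W \<longleftrightarrow> (\<forall>u\<in>?V. \<forall>v\<in>?V. (\<forall>w\<in>W. ?d u w = ?d v w) \<longrightarrow> u = v)"
  proof -
    have "graph_dist (zdg n) u w = graph_dist (zdg n) v w \<longleftrightarrow> ?d u w = ?d v w"
      if "u \<in> ?V" "v \<in> ?V" "w \<in> W" for u v w
      using that True by (subst (1 2) graph_dist_zdg) auto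
    then show ?thesis
      using True finite_subset[OF True finite_pverts_zdg] by (simp add: resolving_set_def)
  qed
  also have "\<dots> \<longleftrightarrow> ?sep"
  proof
    assume sep: ?sep
    show "\<forall>u\<in>?V. \<forall>v\<in>?V. (\<forall>w\<in>W. ?d u w = ?d v w) \<longrightarrow> u = v"
    proof (intro ballI impI, rule ccontr)
      fix u v assume uv: "u \<in> ?V" "v \<in> ?V" "\<forall>w\<in>W. ?d u w = ?d v w" "u \<noteq> v"
      have "u \<notin> W" "v \<notin> W"
        using uv(3,4) pos by (metis less_irrefl)+
      then obtain w where "w \<in> W" "pdist n (pattern u) (pattern w) \<noteq> pdist n (pattern v) (pattern w)"
        using sep uv by blast
      then show False using uv(3) \<open>u \<notin> W\<close> \<open>v \<notin> W\<close> by metis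
    qed
  next
    assume *: "\<forall>u\<in>?V. \<forall>v\<in>?V. (\<forall>w\<in>W. ?d u w = ?d v w) \<longrightarrow> u = v"
    show ?sep
    proof (intro ballI impI)
      fix u v assume uv: "u \<in> ?V - W" "v \<in> ?V - W" "u \<noteq> v"
      then obtain w where w: "w \<in> W" "?d u w \<noteq> ?d v w" using * by auto
      moreover have "u \<noteq> w" "v \<noteq> w" using w uv by auto
      ultimately show "\<exists>w\<in>W. pdist n (pattern u) (pattern w) \<noteq> pdist n (pattern v) (pattern w)"
        by auto
    qed
  qed
  finally show ?thesis using True by simp
qed (auto simp: resolving_set_def)

section \<open>Counting matrices with a given pattern\<close>

lemma sum_Pow_card:
  assumes "finite A"
  shows "(\<Sum>T\<in>Pow A. h (card T)) = (\<Sum>k\<le>card A. of_nat (card A choose k) * (h k :: 'b :: semiring_1))"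
proof -
  have "(\<Sum>T\<in>Pow A. h (card T)) = (\<Sum>k\<le>card A. \<Sum>T\<in>{T \<in> Pow A. card T = k}. h (card T))"
    using assms by (intro sum.group[symmetric]) (auto intro: card_mono)
  also have "\<dots> = (\<Sum>k\<le>card A. of_nat (card A choose k) * h k)"
    using n_subsets[OF assms] by (intro sum.cong) (auto simp: Pow_def)
  finally show ?thesis .
qed

text \<open>Encodes the Boolean matrices with rows \<open>I\<close> and columns \<open>J\<close> and
  without zero rows or columns: \<open>f i\<close> is the support of row \<open>i\<close>.\<close>

definition covers :: "'a set \<Rightarrow> 'b set \<Rightarrow> ('a \<Rightarrow> 'b set) set" where
  "covers I J = {f \<in> I \<rightarrow>\<^sub>E Pow J - {{}}. \<Union>(f ` I) = J}"

text \<open>Moebius inversion on the subsets of \<open>J\<close>: families of nonempty subsets of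
  \<open>S\<close> are easy to count, and each of them covers exactly one subset of
  \<open>S\<close>, its union.\<close>

lemma card_covers:
  assumes I: "finite I" and J: "finite J"
  shows "int (card (covers I J)) =
    (\<Sum>k = 0..card J. (-1) ^ k * int (card J choose k) * (2 ^ (card J - k) - 1) ^ card I)"
proof -
  have total: "(2 ^ card S - 1) ^ card I = (\<Sum>T\<in>Pow S. int (card (covers I T)))" if S: "finite S" for S :: "'b set"
  proof -
    let ?F = "I \<rightarrow>\<^sub>E Pow S - {{}}"
    have "finite ?F" using I S by (intro finite_PiE) auto
    have "(\<Sum>T\<in>Pow S. card (covers I T)) = (\<Sum>T\<in>Pow S. \<Sum>f\<in>{f \<in> ?F. \<Union>(f ` I) = T}. 1)"
    proof (rule sum.cong)
      fix T assume "T \<in> Pow S"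
      have mem: "f \<in> covers I T \<longleftrightarrow> f \<in> ?F \<and> \<Union>(f ` I) = T" for f
      proof (cases "\<Union>(f ` I) = T")
        case True
        then have "f i \<subseteq> T" "f i \<subseteq> S" if "i \<in> I" for i
          using that \<open>T \<in> Pow S\<close> by blast+
        then show ?thesis using True by (simp add: covers_def PiE_iff)
      qed (simp add: covers_def)
      have "covers I T = {f \<in> ?F. \<Union>(f ` I) = T}"
        by (rule Set.set_eqI) (simp only: mem mem_Collect_eq)
      then show "card (covers I T) = (\<Sum>f\<in>{f \<in> ?F. \<Union>(f ` I) = T}. 1)" by simp
    qed simp
    also have "\<dots> = (\<Sum>f\<in>?F. 1)"
      using \<open>finite ?F\<close> S by (intro sum.group) (auto simp: PiE_iff)
    also have "\<dots> = (2 ^ card S - 1) ^ card I"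
      using I S by (simp add: card_PiE card_Diff_subset card_Pow)
    finally have "int (\<Sum>T\<in>Pow S. card (covers I T)) = int ((2 ^ card S - 1) ^ card I)" by simp
    then show ?thesis by (simp add: of_nat_diff)
  qed
  have "int (card (covers I J)) = (\<Sum>T\<in>Pow J. (-1) ^ (card J - card T) * (2 ^ card T - 1) ^ card I)"
    using inclusion_exclusion_mobius[of "\<lambda>S. (2 ^ card S - 1) ^ card I" "\<lambda>T. int (card (covers I T))", OF total J] .
  also have "\<dots> = (\<Sum>t\<le>card J. int (card J choose t) * ((-1) ^ (card J - t) * (2 ^ t - 1) ^ card I))"
    by (rule sum_Pow_card[OF J, of "\<lambda>t. (-1) ^ (card J - t) * (2 ^ t - 1) ^ card I"])
  \<comment> \<open>Reindexing by the size \<open>k\<close> of the complement gives the form of the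
    sum in the theorem.\<close>
  also have "\<dots> = (\<Sum>k\<le>card J. int (card J choose (card J - k)) *
      ((-1) ^ (card J - (card J - k)) * (2 ^ (card J - k) - 1) ^ card I))"
    by (rule sum.nat_diff_reindex[symmetric, of _ "Suc (card J)", simplified lessThan_Suc_atMost, simplified])
  also have "\<dots> = (\<Sum>k = 0..card J. (-1) ^ k * int (card J choose k) * (2 ^ (card J - k) - 1) ^ card I)"
    by (rule sum.cong) (auto simp: atMost_atLeast0 binomial_symmetric[symmetric])
  finally show ?thesis .
qed

text \<open>Deleting the zero rows and columns and recording the supports of the remaining rows is a
  bijection.\<close>

lemma card_pattern_class_covers:
  assumes R: "R \<subset> {..<n}" and C: "C \<subset> {..<n}"
  shows "card {A :: boolean_semiring mat. A \<in> carrier_mat n n \<and> pattern A = (R, C)} =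
    card (covers ({..<n} - R) ({..<n} - C))"
proof (rule bij_betw_same_card)
  let ?I = "{..<n} - R" and ?J = "{..<n} - C"
  let ?supp = "\<lambda>A. \<lambda>i\<in>?I. {j. j < n \<and> A $$ (i, j) \<noteq> (0 :: boolean_semiring)}"
  let ?mat = "\<lambda>f. mat n n (\<lambda>(i, j). if i \<in> ?I \<and> j \<in> f i then 1 else (0 :: boolean_semiring))"
  let ?M = "{A :: boolean_semiring mat. A \<in> carrier_mat n n \<and> pattern A = (R, C)}"
  show "bij_betw ?supp ?M (covers ?I ?J)"
  proof (rule bij_betw_byWitness[where f' = ?mat])
    show "\<forall>A\<in>?M. ?mat (?supp A) = A"
    proof
      fix A assume A: "A \<in> ?M"
      then have "A $$ (i, j) = 0" if "i \<in> R" "i < n" "j < n" for i j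
        using that by (auto simp: pattern_def zero_rows_def)
      then show "?mat (?supp A) = A"
        using A by (auto simp: mat_eq_iff simp flip: boolean_neq_0_iff)
    qed
    show "\<forall>f\<in>covers ?I ?J. ?supp (?mat f) = f"
    proof
      fix f assume f: "f \<in> covers ?I ?J"
      show "?supp (?mat f) = f"
      proof
        fix i
        show "?supp (?mat f) i = f i"
        proof (cases "i \<in> ?I")
          case True
          then have "f i \<subseteq> {..<n}" using f by (auto simp: covers_def)
          then show ?thesis using True by (auto split: if_splits)
        next
          case False
          then show ?thesis using f by (auto simp: covers_def PiE_iff extensional_def)
        qed
      qed
    qed
    show "?supp ` ?M \<subseteq> covers ?I ?J"
    proof
      fix f assume "f \<in> ?supp ` ?M"
      then obtain A where A: "A \<in> carrier_mat n n" "zero_rows A = R" "zero_cols A = C"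
        and f: "f = ?supp A" by (auto simp: pattern_def)
      have r: "i \<in> R \<longleftrightarrow> (\<forall>j<n. A $$ (i, j) = 0)" if "i < n" for i
        using A that by (auto simp: zero_rows_def)
      have c: "j \<in> C \<longleftrightarrow> (\<forall>i<n. A $$ (i, j) = 0)" if "j < n" for j
        using A that by (auto simp: zero_cols_def)
      have fi: "f i \<subseteq> ?J \<and> f i \<noteq> {}" if "i \<in> ?I" for i
        using that r[of i] c by (auto simp: f)
      moreover have "j \<in> \<Union>(f ` ?I)" if j: "j \<in> ?J" for j
      proof -
        obtain i where i: "i < n" "A $$ (i, j) \<noteq> 0" using j c by auto
        then have "i \<in> ?I" using j r by auto
        then show ?thesis using i j by (intro UN_I[of i]) (auto simp: f)
      qed
      moreover have "f \<in> extensional ?I" by (simp add: f)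
      ultimately show "f \<in> covers ?I ?J"
        unfolding covers_def PiE_iff by blast
    qed
    show "?mat ` covers ?I ?J \<subseteq> ?M"
    proof
      fix A assume "A \<in> ?mat ` covers ?I ?J"
      then obtain f where f: "f \<in> covers ?I ?J" and A: "A = ?mat f" by auto
      have fi: "f i \<subseteq> ?J" "f i \<noteq> {}" if "i \<in> ?I" for i
        using f that by (auto simp: covers_def)
      have un: "\<exists>i\<in>?I. j \<in> f i" if "j \<in> ?J" for j
        using f that by (auto simp: covers_def)
      have car: "A \<in> carrier_mat n n" by (simp add: A)
      have "(\<forall>j<n. A $$ (i, j) = 0) \<longleftrightarrow> i \<in> R" if "i < n" for i
        using that fi[of i] by (auto simp: A split: if_splits)
      then have "zero_rows A = R" using car R by (auto simp: zero_rows_def)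
      moreover have "(\<forall>i<n. A $$ (i, j) = 0) \<longleftrightarrow> j \<in> C" if "j < n" for j
        using that fi un[of j] by (auto simp: A split: if_splits)
      then have "zero_cols A = C" using car C by (auto simp: zero_cols_def)
      ultimately show "A \<in> ?M" using car by (simp add: pattern_def)
    qed
  qed
qed

section \<open>Sizes of the classes of twins\<close>

definition pattern_class :: "nat \<Rightarrow> nat set \<times> nat set \<Rightarrow> boolean_semiring mat set" where
  "pattern_class n c = {A \<in> pverts (zdg n). pattern A = c}"

text \<open>With i = \<open>card R\<close> and j = \<open>card C\<close> this is the inner sum of
  the theorem.\<close>

lemma card_pattern_class:
  assumes c: "(R, C) \<in> patterns n"
  shows "int (card (pattern_class n (R, C))) =
    (\<Sum>k = 0..n - card C. (-1) ^ k * int ((n - card C) choose k) *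
       (2 ^ (n - card C - k) - 1) ^ (n - card R))"
proof -
  have "R \<subset> {..<n}" "C \<subset> {..<n}" using c by (auto simp: patterns_def)
  moreover have "card ({..<n} - R) = n - card R" "card ({..<n} - C) = n - card C"
    using calculation by (simp_all add: card_Diff_subset finite_subset[of _ "{..<n}"] less_imp_le)
  moreover have "pattern_class n (R, C) = {A. A \<in> carrier_mat n n \<and> pattern A = (R, C)}"
    using c by (auto simp: pattern_class_def pverts_zdg)
  ultimately show ?thesis
    by (simp add: card_pattern_class_covers card_covers)
qed

lemma pattern_transpose [simp]: "pattern (transpose_mat A) = prod.swap (pattern A)"
  by (auto simp: pattern_def zero_rows_def zero_cols_def)

text \<open>Only one row is nonzero, and a column is nonzero only through its entry in that row; so
  the zero columns determine every entry.\<close>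

lemma eq_pattern_mat:
  assumes A: "A \<in> carrier_mat n n" "pattern A = (R, C)" and "card R = n - 1" "n > 0"
  shows "A = pattern_mat n (R, C)"
proof -
  have R: "R = zero_rows A" and C: "C = zero_cols A" using A by (auto simp: pattern_def)
  have "R \<subseteq> {..<n}" using zero_rows_subset[OF A(1)] R by simp
  then have "card ({..<n} - R) = 1"
    using assms(3,4) by (simp add: card_Diff_subset finite_subset[of _ "{..<n}"])
  then obtain r where r: "{..<n} - R = {r}" by (auto simp: card_1_singleton_iff)
  have "A $$ (i, j) \<noteq> 0 \<longleftrightarrow> i \<notin> R \<and> j \<notin> C" if ij: "i < n" "j < n" for i j
  proof
    assume "A $$ (i, j) \<noteq> 0"
    then show "i \<notin> R \<and> j \<notin> C" using A(1) ij by (auto simp: R C zero_rows_def zero_cols_def)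
  next
    assume *: "i \<notin> R \<and> j \<notin> C"
    then obtain k where "k < n" "A $$ (k, j) \<noteq> 0"
      using A(1) ij by (auto simp: C zero_cols_def)
    moreover have "k \<notin> R" using calculation A(1) ij by (auto simp: R zero_rows_def)
    ultimately have "k \<in> {..<n} - R" "i \<in> {..<n} - R" using * ij by simp_all
    then have "k = i" unfolding r by simp
    then show "A $$ (i, j) \<noteq> 0" using \<open>A $$ (k, j) \<noteq> 0\<close> by simp
  qed
  then show ?thesis using A(1)
    by (auto simp: pattern_mat_def mat_eq_iff simp flip: boolean_neq_0_iff)
qed

lemma pattern_class_unique:
  assumes "A \<in> pattern_class n c" "B \<in> pattern_class n c" "n > 0"
    and "card (fst c) = n - 1 \<or> card (snd c) = n - 1"
  shows "A = B"
proof -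
  have AB: "A \<in> carrier_mat n n" "pattern A = (fst c, snd c)"
    "B \<in> carrier_mat n n" "pattern B = (fst c, snd c)"
    using assms(1,2) by (auto simp: pattern_class_def pverts_zdg)
  from assms(4) show ?thesis
  proof
    assume "card (fst c) = n - 1"
    then show ?thesis using eq_pattern_mat AB assms(3) by metis
  next
    assume "card (snd c) = n - 1"
    then have "transpose_mat A = pattern_mat n (snd c, fst c)"
      "transpose_mat B = pattern_mat n (snd c, fst c)"
      using AB assms(3) by (auto intro!: eq_pattern_mat simp: prod.swap_def)
    then show ?thesis by (metis transpose_transpose)
  qed
qed

text \<open>With two nonzero rows and no zero column, one entry of the full matrix can be erased
  without changing the pattern. Of the two matrices, at least one differs from
  \<open>B\<close>.\<close>

lemma pattern_class_two:
  assumes "n \<ge> 2" and S: "S \<subset> {..<n}" "card S \<ge> 2"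
  shows "\<exists>A \<in> pattern_class n ({..<n} - S, {}). A \<noteq> B"
proof -
  obtain s t where st: "s \<in> S" "t \<in> S" "s \<noteq> t"
    using S(2) by (metis card_2_iff' obtain_subset_with_card_n subsetD)
  let ?c = "({..<n} - S, {})"
  define A where "A = pattern_mat n ?c"
  define A' where "A' = mat n n (\<lambda>(i, j). if i \<notin> S \<or> (i, j) = (s, 0) then 0 else (1 :: boolean_semiring))"
  have "?c \<in> patterns n" using S st by (auto simp: patterns_def)
  then have "A \<in> pattern_class n ?c"
    by (auto simp: pattern_class_def pverts_zdg A_def patterns_def pattern_pattern_mat)
  moreover have "A' \<in> pattern_class n ?c"
  proof -
    have lt: "s < n" "t < n" using S st by auto
    have dim: "dim_row A' = n" "dim_col A' = n" by (simp_all add: A'_def)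
    have "(\<forall>j<n. A' $$ (i, j) = 0) \<longleftrightarrow> i \<notin> S" if "i < n" for i
    proof -
      \<comment> \<open>Only entry \<open>(s, 0)\<close> is erased: row \<open>s\<close> survives
        through column 1, and column 0 survives through row \<open>t\<close>.\<close>
      have "A' $$ (i, 1) = 1" if "i \<in> S" using that \<open>i < n\<close> assms(1) by (simp add: A'_def)
      moreover have "A' $$ (i, j) = 0" if "i \<notin> S" "j < n" for j
        using that \<open>i < n\<close> by (simp add: A'_def)
      moreover have "1 < n" using assms(1) by simp
      ultimately show ?thesis by (metis zero_neq_one)
    qed
    then have "zero_rows A' = {..<n} - S" by (auto simp: zero_rows_def dim)
    moreover have "A' $$ (t, j) \<noteq> 0" if "j < n" for j
      using that lt st by (simp add: A'_def)
    then have "zero_cols A' = {}" using lt by (auto simp: zero_cols_def dim)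
    ultimately have "pattern A' = ?c" by (simp add: pattern_def)
    then show ?thesis using \<open>?c \<in> patterns n\<close>
      by (auto simp: pattern_class_def pverts_zdg A'_def)
  qed
  moreover have "A \<noteq> A'"
  proof -
    have "A $$ (s, 0) \<noteq> A' $$ (s, 0)" using S st by (auto simp: A_def A'_def pattern_mat_def)
    then show ?thesis by auto
  qed
  ultimately show ?thesis by metis
qed

lemma pattern_class_swap:
  "A \<in> pattern_class n c \<Longrightarrow> transpose_mat A \<in> pattern_class n (prod.swap c)"
  by (auto simp: pattern_class_def pverts_zdg)

lemma finite_patterns: "finite (patterns n)"
  by (rule finite_subset[of _ "Pow {..<n} \<times> Pow {..<n}"]) (auto simp: patterns_def)

text \<open>The difference adds up class size minus 1 over all patterns. Classes with a single
  nonzero row or column contribute 0; the others are grouped by the numbers of zero rows and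
  columns.\<close>

lemma card_pverts_minus_patterns:
  assumes n: "n \<ge> 2"
  shows "int (card (pverts (zdg n))) - int (card (patterns n)) =
    (\<Sum>(i, j) \<in> ({0..n - 2} \<times> {0..n - 2}) - {(0, 0)}.
      int (n choose i) * int (n choose j) *
      ((\<Sum>k = 0..n - j. (-1) ^ k * int ((n - j) choose k) * (2 ^ (n - j - k) - 1) ^ (n - i)) - 1))"
    (is "_ = (\<Sum>(i, j) \<in> ?IJ. int (n choose i) * int (n choose j) * (?N i j - 1))")
proof -
  let ?size = "\<lambda>c. int (card (pattern_class n c))"
  define K where "K = {c \<in> patterns n. card (fst c) \<le> n - 2 \<and> card (snd c) \<le> n - 2}"
  have "(\<Sum>c\<in>patterns n. card (pattern_class n c)) = card (pverts (zdg n))"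
  proof -
    have "(\<Sum>c\<in>patterns n. card (pattern_class n c)) =
        (\<Sum>c\<in>patterns n. \<Sum>A\<in>{A \<in> pverts (zdg n). pattern A = c}. 1)"
      by (simp add: pattern_class_def)
    also have "\<dots> = (\<Sum>A\<in>pverts (zdg n). 1)"
      using finite_pverts_zdg finite_patterns by (intro sum.group) (auto simp: pverts_zdg)
    finally show ?thesis by simp
  qed
  then have "int (card (pverts (zdg n))) - int (card (patterns n)) = (\<Sum>c\<in>patterns n. ?size c - 1)"
    by (simp add: sum_subtractf flip: of_nat_sum)
  also have "\<dots> = (\<Sum>c\<in>K. ?size c - 1)"
  proof (rule sum.mono_neutral_right)
    show "\<forall>c\<in>patterns n - K. ?size c - 1 = 0"
    proof
      fix c assume c: "c \<in> patterns n - K"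
      have "fst c \<subset> {..<n}" "snd c \<subset> {..<n}" using c by (simp_all add: patterns_iff)
      then have lt: "card (fst c) < n" "card (snd c) < n"
        using psubset_card_mono[OF finite_lessThan, of _ n] by auto
      then have "card (fst c) = n - 1 \<or> card (snd c) = n - 1"
        using c n by (auto simp: K_def)
      then have uniq: "B = A" if "A \<in> pattern_class n c" "B \<in> pattern_class n c" for A B
        using pattern_class_unique[OF that(2,1)] n by simp
      obtain A where "A \<in> pattern_class n c"
        using c pattern_surj unfolding pattern_class_def by blast
      then have "pattern_class n c = {A}" using uniq by blast
      then show "?size c - 1 = 0" by simp
    qed
  qed (auto simp: K_def finite_patterns)
  also have "\<dots> = (\<Sum>(R, C)\<in>K. ?N (card R) (card C) - 1)"
    by (rule sum.cong) (auto simp: K_def card_pattern_class)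
  also have "\<dots> = (\<Sum>p\<in>?IJ. \<Sum>c\<in>{c \<in> K. (\<lambda>(R, C). (card R, card C)) c = p}. case c of (R, C) \<Rightarrow> ?N (card R) (card C) - 1)"
  proof (rule sum.group[symmetric])
    show "(\<lambda>(R, C). (card R, card C)) ` K \<subseteq> ?IJ"
      by (auto simp: K_def patterns_def finite_subset[of _ "{..<n}"])
  qed (auto simp: K_def finite_patterns)
  also have "\<dots> = (\<Sum>(i, j) \<in> ?IJ. int (n choose i) * int (n choose j) * (?N i j - 1))"
  proof (rule sum.cong[OF refl])
    fix p assume "p \<in> ?IJ"
    then obtain i j where p: "p = (i, j)" and ij: "i \<in> {0..n-2}" "j \<in> {0..n-2}" "(i, j) \<noteq> (0, 0)"
      by blast
    let ?S = "\<lambda>i. {R. R \<subseteq> {..<n} \<and> card R = i}"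
    \<comment> \<open>The bound \<open>n - 2\<close> makes all these subsets proper, and
      \<open>(i, j)\<close> differing from \<open>(0, 0)\<close> excludes the pattern
      \<open>({}, {})\<close>.\<close>
    have "{c \<in> K. (\<lambda>(R, C). (card R, card C)) c = (i, j)} = ?S i \<times> ?S j"
      using ij n by (auto simp: K_def patterns_def)
    moreover have "(\<Sum>c\<in>?S i \<times> ?S j. case c of (R, C) \<Rightarrow> ?N (card R) (card C) - 1) =
        (\<Sum>c\<in>?S i \<times> ?S j. ?N i j - 1)"
      by (rule sum.cong) auto
    moreover have "card (?S i \<times> ?S j) = (n choose i) * (n choose j)"
      using n_subsets[of "{..<n}"] by (simp add: card_cartesian_product)
    ultimately show "(\<Sum>c\<in>{c \<in> K. (\<lambda>(R, C). (card R, card C)) c = p}.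
        case c of (R, C) \<Rightarrow> ?N (card R) (card C) - 1) =
        (case p of (i, j) \<Rightarrow> int (n choose i) * int (n choose j) * (?N i j - 1))"
      by (simp only: p prod.case) simp
  qed
  finally show ?thesis .
qed

section \<open>A resolving set\<close>

text \<open>The patterns of a full row and of a full column. The index \<open>n - 1\<close> is left
  out in both families, which is what saves two vertices.\<close>

definition corners :: "nat \<Rightarrow> (nat set \<times> nat set) set" where
  "corners n = (\<lambda>a. ({..<n} - {a}, {})) ` {..<n - 1} \<union> (\<lambda>a. ({}, {..<n} - {a})) ` {..<n - 1}"

lemma corners_swap: "prod.swap c \<in> corners n \<longleftrightarrow> c \<in> corners n"
  by (cases c) (auto simp: corners_def)

lemma corners_subset: "n \<ge> 2 \<Longrightarrow> corners n \<subseteq> patterns n"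
proof
  fix c assume n: "n \<ge> 2" and c: "c \<in> corners n"
  have *: "{..<n} - {a} \<noteq> {}" "{..<n} - {a} \<subset> {..<n}" "{} \<subset> {..<n}" if "a < n - 1" for a
  proof -
    have "n - 1 \<in> {..<n} - {a}" "a \<in> {..<n}" using that n by auto
    then show "{..<n} - {a} \<noteq> {}" "{..<n} - {a} \<subset> {..<n}" "{} \<subset> {..<n}" by blast+
  qed
  from c obtain a where a: "a < n - 1" "c = ({..<n} - {a}, {}) \<or> c = ({}, {..<n} - {a})"
    unfolding corners_def by blast
  then show "c \<in> patterns n"
    using *[OF a(1)] by (elim disjE) (simp_all only: patterns_iff fst_conv snd_conv prod.inject simp_thms)
qed

lemma card_corners: "n \<ge> 2 \<Longrightarrow> card (corners n) = 2 * (n - 1)"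
proof -
  assume n: "n \<ge> 2"
  let ?A = "(\<lambda>a. ({..<n} - {a}, {} :: nat set)) ` {..<n - 1}"
  let ?B = "(\<lambda>a. ({} :: nat set, {..<n} - {a})) ` {..<n - 1}"
  have inj: "a = b" if "a < n - 1" "{..<n} - {a} = {..<n} - {b}" for a b
  proof -
    have "a \<notin> {..<n} - {b}" using that(2) by blast
    then show ?thesis using that(1) by simp
  qed
  have "fst p \<noteq> {}" if "p \<in> ?A" for p
  proof -
    from that obtain a where "p = ({..<n} - {a}, {})" "a \<in> {..<n - 1}" by (rule imageE)
    then have "n - 1 \<in> fst p" by auto
    then show ?thesis by blast
  qed
  moreover have "fst p = {}" if "p \<in> ?B" for p using that by auto
  ultimately have "?A \<inter> ?B = {}" by blast
  then have "card (corners n) = card ?A + card ?B"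
    unfolding corners_def by (intro card_Un_disjoint) simp_all
  also have "card ?A = n - 1"
    using inj by (subst card_image) (simp_all add: inj_on_def)
  also have "card ?B = n - 1"
    using inj by (subst card_image) (simp_all add: inj_on_def)
  finally show ?thesis by simp
qed

text \<open>The probing matrix has no zero column, so it can annihilate only from the right, and its
  nonzero rows \<open>S\<close> must then meet zero columns.\<close>

lemma pdist_detects_subset:
  assumes "c \<in> patterns n" "S \<subseteq> {..<n}"
  shows "pdist n c ({..<n} - S, {}) = 1 \<longleftrightarrow> S \<subseteq> snd c"
proof -
  have "fst c \<subset> {..<n}" "snd c \<subset> {..<n}" using assms(1) by (auto simp: patterns_iff)
  then have "adj n c ({..<n} - S, {}) \<longleftrightarrow> S \<subseteq> snd c"
    using assms(2) unfolding adj_def fst_conv snd_conv by blast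
  then show ?thesis by (simp add: pdist_def)
qed

text \<open>The inclusion \<open>S \<subseteq> snd c\<close> can be read off the resolving set constructed below for every such \<open>S\<close>;
  it contains no matrix that tests for \<open>{n - 1}\<close>.\<close>

definition probe :: "nat \<Rightarrow> nat set \<Rightarrow> bool" where
  "probe n S \<longleftrightarrow> S \<subset> {..<n} \<and> S \<noteq> {} \<and> S \<noteq> {n - 1}"

text \<open>Testing with \<open>X\<close> and with \<open>Y\<close> gives both inclusions unless one
  of the sets is the forbidden \<open>{n - 1}\<close>; the other is then a proper subset of a
  singleton.\<close>

lemma probe_determines_subset:
  assumes X: "X \<subset> {..<n}" and Y: "Y \<subset> {..<n}"
    and eq: "\<And>S. probe n S \<Longrightarrow> S \<subseteq> X \<longleftrightarrow> S \<subseteq> Y" and "X \<noteq> Y"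
  shows "X = {} \<or> Y = {}"
proof (rule ccontr)
  assume ne: "\<not> (X = {} \<or> Y = {})"
  have "X \<subseteq> Y" if "X \<noteq> {n - 1}" using eq[of X] X ne that by (auto simp: probe_def)
  moreover have "Y \<subseteq> X" if "Y \<noteq> {n - 1}" using eq[of Y] Y ne that by (auto simp: probe_def)
  ultimately consider "X = {n - 1}" "Y \<subseteq> X" | "Y = {n - 1}" "X \<subseteq> Y" using \<open>X \<noteq> Y\<close> by blast
  then show False using ne \<open>X \<noteq> Y\<close> by cases blast+
qed

text \<open>Settles the case left open by adjacency tests, using distance 3: if row \<open>t\<close>
  of \<open>d\<close> is nonzero, then \<open>({t}, {})\<close> is far from \<open>d\<close>, but
  not from \<open>c\<close>, which has a zero column.\<close>

lemma probe_detects_empty: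
  assumes n: "n \<ge> 2" and c: "c \<in> patterns n" "snd c \<noteq> {}"
    and d: "d \<in> patterns n" "snd d = {}" "d \<notin> corners n"
  shows "\<exists>S. probe n S \<and> pdist n c ({..<n} - S, {}) \<noteq> pdist n d ({..<n} - S, {})"
proof -
  have fd: "fst d \<subset> {..<n}" using d by (auto simp: patterns_iff)
  \<comment> \<open>The probe \<open>{..<n} - {t}\<close> can be the forbidden
    \<open>{n - 1}\<close> only for \<open>n = 2\<close> and \<open>t = 0\<close>. Then
    \<open>t = 1\<close> is chosen instead, which fails only if \<open>d\<close> is a
    corner.\<close>
  have "\<exists>t<n. t \<notin> fst d \<and> {..<n} - {t} \<noteq> {n - 1}"
  proof (cases "n = 2")
    case True
    have "1 \<notin> fst d"
    proof
      assume "1 \<in> fst d"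
      then have "fst d = {..<n} - {0}" using fd True by (auto simp: less_2_cases_iff)
      then have "d \<in> corners n" using d(2) True by (cases d) (auto simp: corners_def)
      then show False using d by simp
    qed
    then show ?thesis using True by (intro exI[of _ 1]) auto
  next
    case False
    obtain t where t: "t < n" "t \<notin> fst d" using fd by blast
    have "card ({..<n} - {t}) \<noteq> card {n - 1}" using t False n by simp
    then have "{..<n} - {t} \<noteq> {n - 1}" by metis
    then show ?thesis using t by blast
  qed
  then obtain t where t: "t < n" "t \<notin> fst d" "{..<n} - {t} \<noteq> {n - 1}" by blast
  have I: "{..<n} - ({..<n} - {t}) = {t}" using t by auto
  have "card ({..<n} - {t}) \<noteq> card {}" using t n by simp
  then have "{..<n} - {t} \<noteq> {}" by metis
  then have "probe n ({..<n} - {t})" using t by (auto simp: probe_def)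
  moreover have "far d ({t}, {})" using d(2) t by (auto simp: far_def)
  moreover have "\<not> far c ({t}, {})" using c by (auto simp: far_def)
  moreover have "\<not> adj n d ({t}, {})"
  proof -
    have "card {t} \<noteq> card {..<n}" using n by simp
    then have "{t} \<noteq> {..<n}" by metis
    then show ?thesis using d fd by (auto simp: adj_def)
  qed
  ultimately show ?thesis by (intro exI[of _ "{..<n} - {t}"]) (auto simp: I pdist_def)
qed

lemma probe_separates_snd:
  assumes n: "n \<ge> 2" and c: "c \<in> patterns n" "c \<notin> corners n"
    and d: "d \<in> patterns n" "d \<notin> corners n" and "snd c \<noteq> snd d"
  shows "\<exists>S. probe n S \<and> pdist n c ({..<n} - S, {}) \<noteq> pdist n d ({..<n} - S, {})"
proof (rule ccontr)
  assume "\<not> ?thesis"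
  then have eq: "pdist n c ({..<n} - S, {}) = pdist n d ({..<n} - S, {})" if "probe n S" for S
    using that by blast
  then have "S \<subseteq> snd c \<longleftrightarrow> S \<subseteq> snd d" if "probe n S" for S
    using that pdist_detects_subset[OF c(1), of S] pdist_detects_subset[OF d(1), of S]
    by (auto simp: probe_def)
  then have "snd c = {} \<or> snd d = {}"
    using probe_determines_subset[of "snd c" n "snd d"] c(1) d(1) \<open>snd c \<noteq> snd d\<close>
    by (auto simp: patterns_iff)
  then show False
    using probe_detects_empty[OF n c(1) _ d(1)] probe_detects_empty[OF n d(1) _ c(1)] c d eq
      \<open>snd c \<noteq> snd d\<close> by metis
qed

text \<open>If the zero columns agree, the zero rows differ, and transposition reduces to
  \<open>probe_separates_snd\<close>.\<close>

lemma probe_separates: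
  assumes n: "n \<ge> 2" and c: "c \<in> patterns n" "c \<notin> corners n"
    and d: "d \<in> patterns n" "d \<notin> corners n" and "c \<noteq> d"
  shows "\<exists>S. probe n S \<and> (pdist n c ({..<n} - S, {}) \<noteq> pdist n d ({..<n} - S, {}) \<or>
    pdist n c ({}, {..<n} - S) \<noteq> pdist n d ({}, {..<n} - S))"
proof (cases "snd c = snd d")
  case True
  then have "snd (prod.swap c) \<noteq> snd (prod.swap d)" using \<open>c \<noteq> d\<close> by (auto simp: prod_eq_iff)
  then obtain S where "probe n S"
    "pdist n (prod.swap c) ({..<n} - S, {}) \<noteq> pdist n (prod.swap d) ({..<n} - S, {})"
    using probe_separates_snd[of n "prod.swap c" "prod.swap d"] n c d by (auto simp: corners_swap)
  moreover have "({..<n} - S, {}) = prod.swap ({}, {..<n} - S)" by simp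
  ultimately show ?thesis by (metis pdist_swap)
next
  case False
  then show ?thesis using probe_separates_snd[OF n c d] by blast
qed

definition representative :: "nat \<Rightarrow> nat set \<times> nat set \<Rightarrow> boolean_semiring mat" where
  "representative n c = (SOME A. A \<in> pattern_class n c)"

lemma representative:
  assumes "c \<in> patterns n"
  shows "representative n c \<in> pverts (zdg n)" "pattern (representative n c) = c"
proof -
  have "\<exists>A. A \<in> pattern_class n c" using pattern_surj[OF assms] unfolding pattern_class_def by blast
  then have "representative n c \<in> pattern_class n c" unfolding representative_def by (rule someI_ex)
  then show "representative n c \<in> pverts (zdg n)" "pattern (representative n c) = c"
    by (simp_all add: pattern_class_def)
qed

text \<open>Omitting one vertex of every pattern is the most that twins allow. The corners have only
  one matrix each, so omitting it would lose the probe; it is put back.\<close>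

definition zdg_basis :: "nat \<Rightarrow> boolean_semiring mat set" where
  "zdg_basis n = (pverts (zdg n) - representative n ` patterns n) \<union> representative n ` corners n"

lemma inj_on_representative: "inj_on (representative n) (patterns n)"
  by (rule inj_on_inverseI[of _ pattern]) (simp add: representative)

lemma card_zdg_basis:
  assumes n: "n \<ge> 2"
  shows "int (card (zdg_basis n)) =
    int (card (pverts (zdg n))) - int (card (patterns n)) + 2 * (int n - 1)"
proof -
  have sub: "representative n ` patterns n \<subseteq> pverts (zdg n)" by (auto simp: representative)
  have "card (zdg_basis n) =
      card (pverts (zdg n) - representative n ` patterns n) + card (representative n ` corners n)"
    unfolding zdg_basis_def using corners_subset[OF n] finite_pverts_zdg finite_patterns
    by (intro card_Un_disjoint) (auto intro: finite_subset[OF corners_subset[OF n] finite_patterns])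
  moreover have "card (representative n ` corners n) = 2 * (n - 1)"
    using inj_on_subset[OF inj_on_representative corners_subset[OF n]] card_corners[OF n]
    by (simp add: card_image)
  moreover have "card (pverts (zdg n) - representative n ` patterns n) =
      card (pverts (zdg n)) - card (patterns n)"
    using sub finite_patterns inj_on_representative by (simp add: card_Diff_subset card_image)
  moreover have "card (patterns n) \<le> card (pverts (zdg n))"
    using card_inj_on_le[OF inj_on_representative sub finite_pverts_zdg] .
  ultimately show ?thesis using n by (simp add: of_nat_diff)
qed

text \<open>For a singleton \<open>S\<close> the matrix is the restored corner; for larger
  \<open>S\<close> the class has a second element besides its representative.\<close>

lemma zdg_basis_probe:
  assumes n: "n \<ge> 2" and S: "probe n S"
  shows "\<exists>w \<in> zdg_basis n. pattern w = ({..<n} - S, {})"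
    and "\<exists>w \<in> zdg_basis n. pattern w = ({}, {..<n} - S)"
proof -
  have S': "S \<subset> {..<n}" "S \<noteq> {}" "S \<noteq> {n - 1}" using S by (auto simp: probe_def)
  have fin: "finite S" using S' finite_subset by blast
  have nonrep: "w \<in> zdg_basis n" if "w \<in> pattern_class n c" "w \<noteq> representative n c" for w c
    using that by (auto simp: zdg_basis_def pattern_class_def representative)
  have corner: "\<exists>w \<in> zdg_basis n. pattern w = c" if "c \<in> corners n" for c
    using that corners_subset[OF n] representative(2)[of c n] by (auto simp: zdg_basis_def)
  consider a where "S = {a}" "a < n - 1" | "card S \<ge> 2"
  proof (cases "card S = 1")
    case True
    then obtain a where "S = {a}" by (auto simp: card_1_singleton_iff)
    moreover have "a < n" "a \<noteq> n - 1" using S' calculation by auto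
    ultimately show ?thesis using that(1)[of a] by simp
  next
    case False
    moreover have "card S \<noteq> 0" using S' fin by simp
    ultimately show ?thesis using that(2) by linarith
  qed
  then have "(\<exists>w \<in> zdg_basis n. pattern w = ({..<n} - S, {})) \<and>
    (\<exists>w \<in> zdg_basis n. pattern w = ({}, {..<n} - S))"
  proof cases
    case 1
    then show ?thesis by (auto intro!: corner simp: corners_def)
  next
    case 2
    obtain A where A: "A \<in> pattern_class n ({..<n} - S, {})" "A \<noteq> representative n ({..<n} - S, {})"
      using pattern_class_two[OF n S'(1) 2] by blast
    \<comment> \<open>Avoiding the transposed representative ensures that the transpose of
      \<open>B\<close> is not the representative of its own class.\<close>
    obtain B where B: "B \<in> pattern_class n ({..<n} - S, {})"
      "B \<noteq> transpose_mat (representative n ({}, {..<n} - S))"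
      using pattern_class_two[OF n S'(1) 2] by blast
    have B': "transpose_mat B \<in> pattern_class n ({}, {..<n} - S)"
      using pattern_class_swap[OF B(1)] by simp
    moreover have "transpose_mat B \<noteq> representative n ({}, {..<n} - S)"
      using B(2) by (metis transpose_transpose)
    ultimately have "transpose_mat B \<in> zdg_basis n" "A \<in> zdg_basis n"
      using nonrep A by simp_all
    moreover have "pattern A = ({..<n} - S, {})" "pattern (transpose_mat B) = ({}, {..<n} - S)"
      using A(1) B' unfolding pattern_class_def by simp_all
    ultimately show ?thesis by blast
  qed
  then show "\<exists>w \<in> zdg_basis n. pattern w = ({..<n} - S, {})"
    and "\<exists>w \<in> zdg_basis n. pattern w = ({}, {..<n} - S)" by blast+
qed

lemma resolving_zdg_basis:
  assumes n: "n \<ge> 2"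
  shows "resolving_set (zdg n) (zdg_basis n)"
  unfolding resolving_set_zdg_iff
proof (intro conjI ballI impI)
  show "zdg_basis n \<subseteq> pverts (zdg n)"
    using corners_subset[OF n] by (auto simp: zdg_basis_def representative)
  fix u v assume uv: "u \<in> pverts (zdg n) - zdg_basis n" "v \<in> pverts (zdg n) - zdg_basis n" "u \<noteq> v"
  have rep: "x = representative n (pattern x) \<and> pattern x \<in> patterns n \<and> pattern x \<notin> corners n"
    if x: "x \<in> pverts (zdg n) - zdg_basis n" for x
  proof -
    obtain c where c: "c \<in> patterns n" "x = representative n c"
      using x unfolding zdg_basis_def by blast
    then have "pattern x = c" by (simp add: representative)
    moreover have "c \<notin> corners n" using x c by (auto simp: zdg_basis_def)
    ultimately show ?thesis using c by simp
  qed
  have "pattern u \<noteq> pattern v" using rep[OF uv(1)] rep[OF uv(2)] uv(3) by metis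
  then obtain S where S: "probe n S"
    "pdist n (pattern u) ({..<n} - S, {}) \<noteq> pdist n (pattern v) ({..<n} - S, {}) \<or>
     pdist n (pattern u) ({}, {..<n} - S) \<noteq> pdist n (pattern v) ({}, {..<n} - S)"
    using probe_separates[OF n] rep[OF uv(1)] rep[OF uv(2)] by blast
  then show "\<exists>w\<in>zdg_basis n. pdist n (pattern u) (pattern w) \<noteq> pdist n (pattern v) (pattern w)"
    using zdg_basis_probe[OF n S(1)] by metis
qed

section \<open>Every resolving set is large\<close>

text \<open>The bound \<open>n - 2\<close> on the zero columns asks for at least two nonzero
  columns. The analogue for columns is obtained by swapping the components in
  \<open>F\<close>.\<close>

definition x_lines :: "nat \<Rightarrow> (nat set \<times> nat set) set \<Rightarrow> nat set" where
  "x_lines n F = {a. a < n \<and> (\<exists>C. card C \<le> n - 2 \<and> ({..<n} - {a}, C) \<in> F)}"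

text \<open>Positions of the matrix units whose patterns lie in \<open>F\<close>.\<close>

definition z_lines :: "nat \<Rightarrow> (nat set \<times> nat set) set \<Rightarrow> (nat \<times> nat) set" where
  "z_lines n F = {(a, b). a < n \<and> b < n \<and> ({..<n} - {a}, {..<n} - {b}) \<in> F}"

text \<open>\<open>F\<close> and \<open>P\<close> stand for the patterns of a resolving set \<open>W\<close>: those all of whose matrices lie in
  \<open>W\<close>, and those of at least one matrix in \<open>W\<close>.\<close>

definition separating :: "nat \<Rightarrow> (nat set \<times> nat set) set \<Rightarrow> (nat set \<times> nat set) set \<Rightarrow> bool" where
  "separating n F P \<longleftrightarrow> F \<subseteq> patterns n \<and> P \<subseteq> patterns n \<and>
     (\<forall>e \<in> P. card (fst e) = n - 1 \<or> card (snd e) = n - 1 \<longrightarrow> e \<in> F) \<and>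
     (\<forall>c \<in> patterns n - F. \<forall>d \<in> patterns n - F. c \<noteq> d \<longrightarrow> (\<exists>e \<in> P. pdist n c e \<noteq> pdist n d e))"

lemma separating_swap:
  assumes "separating n F P"
  shows "separating n (prod.swap ` F) (prod.swap ` P)"
proof -
  have mem: "c \<in> prod.swap ` X \<longleftrightarrow> prod.swap c \<in> X" for c and X :: "(nat set \<times> nat set) set"
    by (metis imageE image_eqI swap_swap)
  have "\<exists>e \<in> prod.swap ` P. pdist n c e \<noteq> pdist n d e"
    if "c \<in> patterns n - prod.swap ` F" "d \<in> patterns n - prod.swap ` F" "c \<noteq> d" for c d
  proof -
    have "prod.swap c \<in> patterns n - F" "prod.swap d \<in> patterns n - F" "prod.swap c \<noteq> prod.swap d"
      using that mem by (auto dest: injD[OF inj_swap])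
    then obtain e where "e \<in> P" "pdist n (prod.swap c) e \<noteq> pdist n (prod.swap d) e"
      using assms unfolding separating_def by blast
    then show ?thesis by (intro bexI[of _ "prod.swap e"]) (metis pdist_swap swap_swap, simp)
  qed
  moreover have "prod.swap ` X \<subseteq> patterns n" if "X \<subseteq> patterns n" for X
    using that patterns_swap by blast
  moreover have "\<forall>e \<in> prod.swap ` P. card (fst e) = n - 1 \<or> card (snd e) = n - 1 \<longrightarrow> e \<in> prod.swap ` F"
  proof (intro ballI impI)
    fix e assume "e \<in> prod.swap ` P" "card (fst e) = n - 1 \<or> card (snd e) = n - 1"
    then have "prod.swap e \<in> P" "card (fst (prod.swap e)) = n - 1 \<or> card (snd (prod.swap e)) = n - 1"
      using mem by auto
    then show "e \<in> prod.swap ` F" using assms mem unfolding separating_def by blast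
  qed
  ultimately show ?thesis using assms unfolding separating_def by simp
qed

text \<open>The patterns with the single nonzero row \<open>r\<close> and the single zero column
  \<open>a\<close> or \<open>a'\<close> are outside \<open>F\<close>. A pattern \<open>e\<close>
  separating them must have \<open>a\<close> or \<open>a'\<close> as its only nonzero row and must
  not have \<open>r\<close> as a zero column. Such an \<open>e\<close> lies in \<open>F\<close>, so
  \<open>x_lines\<close> leaves it only one nonzero column, namely \<open>r\<close>.\<close>

lemma separating_z_lines:
  assumes n: "n \<ge> 3" and sep: "separating n F P"
    and r: "r < n" "r \<notin> x_lines n F"
    and a: "a < n" "a \<notin> x_lines n F" and a': "a' < n" "a' \<notin> x_lines n F" and "a \<noteq> a'"
  shows "(a, r) \<in> z_lines n F \<or> (a', r) \<in> z_lines n F"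
proof -
  let ?R = "{..<n} - {r}"
  have key: "(s, r) \<in> z_lines n F"
    if s: "s < n" "s \<notin> x_lines n F" and e: "e \<in> P" "{s} \<union> fst e = {..<n}" "r \<notin> snd e" for s e
  proof -
    have "e \<in> patterns n" using sep e(1) unfolding separating_def by blast
    then have sub: "fst e \<subset> {..<n}" "snd e \<subset> {..<n}" by (simp_all add: patterns_iff)
    have fe: "fst e = {..<n} - {s}"
    proof -
      have "s \<notin> fst e"
      proof
        assume "s \<in> fst e"
        then have "fst e = {..<n}" using e(2) by (simp add: insert_absorb)
        then show False using sub(1) by simp
      qed
      then show ?thesis unfolding e(2)[symmetric] by simp
    qed
    then have "card (fst e) = n - 1" using s by simp
    then have "e \<in> F" using sep e(1) by (auto simp: separating_def)
    then have eF: "({..<n} - {s}, snd e) \<in> F" using fe by (metis prod.collapse)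
    then have "card (snd e) > n - 2" using s by (auto simp: x_lines_def not_le)
    moreover have "snd e \<subseteq> ?R" using sub e(3) by blast
    moreover have "card ?R = n - 1" using r by simp
    ultimately have "snd e = ?R" by (intro card_seteq) auto
    then show ?thesis using eF s r by (simp add: z_lines_def)
  qed
  have Rne: "?R \<noteq> {}" "?R \<subset> {..<n}"
  proof -
    have "card ?R \<noteq> card {}" using n r by simp
    then show "?R \<noteq> {}" by metis
    show "?R \<subset> {..<n}" using r by blast
  qed
  have s: "(?R, {s}) \<in> patterns n - F" if "s < n" for s
  proof -
    have "card {s} \<noteq> card {..<n}" using n by simp
    then have "{s} \<noteq> {..<n}" by metis
    then have "{s} \<subset> {..<n}" using that by blast
    then have "(?R, {s}) \<in> patterns n" using Rne unfolding patterns_iff by simp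
    moreover have "(?R, {s}) \<notin> F"
    proof
      assume "(?R, {s}) \<in> F"
      moreover have "card {s} \<le> n - 2" using n by simp
      ultimately show False using r unfolding x_lines_def by blast
    qed
    ultimately show ?thesis by simp
  qed
  have "(?R, {a}) \<noteq> (?R, {a'})" using \<open>a \<noteq> a'\<close> by simp
  then obtain e where e: "e \<in> P" "pdist n (?R, {a}) e \<noteq> pdist n (?R, {a'}) e"
    using sep s[OF a(1)] s[OF a'(1)] unfolding separating_def by blast
  \<comment> \<open>Both patterns have zero rows and zero columns, so distance 3 never occurs and
    only adjacency can separate them.\<close>
  have notfar: "\<not> far (?R, {s}) e" for s using Rne by (auto simp: far_def)
  have "adj n (?R, {a}) e \<noteq> adj n (?R, {a'}) e"
    using e(2) unfolding pdist_def by (simp only: notfar if_False) (simp split: if_splits)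
  moreover have "adj n (?R, {s}) e \<longleftrightarrow> {s} \<union> fst e = {..<n} \<or> r \<in> snd e" if "s < n" for s
  proof -
    have "e \<in> patterns n" using sep e(1) unfolding separating_def by blast
    then have "snd e \<subset> {..<n}" by (simp add: patterns_iff)
    then have "snd e \<union> ?R = {..<n} \<longleftrightarrow> r \<in> snd e" using r by blast
    then show ?thesis by (simp add: adj_def)
  qed
  ultimately show ?thesis using key[OF a e(1)] key[OF a' e(1)] a(1) a'(1) by metis
qed

text \<open>For each \<open>r\<close> outside \<open>x_lines\<close>, at most one \<open>a\<close>
  outside \<open>x_lines\<close> fails to give a matrix unit at \<open>(a, r)\<close>. Counting over
  all \<open>r\<close> gives the product.\<close>

lemma card_z_lines:
  assumes n: "n \<ge> 3" and sep: "separating n F P"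
  shows "(n - card (x_lines n F)) * (n - card (x_lines n F) - 1) \<le> card (z_lines n F)"
proof -
  let ?Y = "{..<n} - x_lines n F"
  let ?Z = "\<lambda>r. {a \<in> ?Y. (a, r) \<in> z_lines n F}"
  have card_Y: "card ?Y = n - card (x_lines n F)"
    by (subst card_Diff_subset) (auto simp: x_lines_def)
  have Z: "card ?Y - 1 \<le> card (?Z r)" if r: "r \<in> ?Y" for r
  proof -
    have "\<forall>a \<in> ?Y - ?Z r. \<forall>a' \<in> ?Y - ?Z r. a = a'"
      using separating_z_lines[OF n sep] r by fastforce
    then have "card (?Y - ?Z r) \<le> 1"
      by (subst card_le_Suc0_iff_eq[unfolded One_nat_def[symmetric]]) auto
    moreover have "card (?Y - ?Z r) = card ?Y - card (?Z r)"
      by (intro card_Diff_subset) auto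
    ultimately show ?thesis by simp
  qed
  have "card ?Y * (card ?Y - 1) = (\<Sum>r\<in>?Y. card ?Y - 1)" by simp
  also have "\<dots> \<le> (\<Sum>r\<in>?Y. card (?Z r))" using Z by (rule sum_mono)
  also have "\<dots> = card (SIGMA r:?Y. ?Z r)" by simp
  also have "\<dots> = card (prod.swap ` (SIGMA r:?Y. ?Z r))" by (simp add: card_image)
  also have "\<dots> \<le> card (z_lines n F)"
  proof (rule card_mono)
    show "finite (z_lines n F)"
      by (rule finite_subset[of _ "{..<n} \<times> {..<n}"]) (auto simp: z_lines_def)
  qed auto
  finally show ?thesis by (simp add: card_Y)
qed

text \<open>The three counts come from disjoint parts of \<open>F\<close>: one nonzero row with
  several nonzero columns, the transposed kind, and matrix units.\<close>

lemma card_lines_le: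
  assumes n: "n \<ge> 2" and F: "F \<subseteq> patterns n"
  shows "card (x_lines n F) + card (x_lines n (prod.swap ` F)) + card (z_lines n F) \<le> card F"
proof -
  define A where "A = {e \<in> F. card (fst e) = n - 1 \<and> card (snd e) \<le> n - 2}"
  define B where "B = {e \<in> F. card (snd e) = n - 1 \<and> card (fst e) \<le> n - 2}"
  define C where "C = {e \<in> F. card (fst e) = n - 1 \<and> card (snd e) = n - 1}"
  have fin: "finite F" using F finite_patterns finite_subset by blast
  have inj: "a = b" if "a < n" "{..<n} - {a} = {..<n} - {b}" for a b
  proof -
    have "a \<notin> {..<n} - {b}" using that(2) by blast
    then show ?thesis using that(1) by simp
  qed
  have "card (x_lines n F) = card ((\<lambda>a. {..<n} - {a}) ` x_lines n F)"
    by (rule card_image[symmetric]) (rule inj_onI, simp add: x_lines_def inj)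
  also have "\<dots> \<le> card (fst ` A)"
  proof (rule card_mono)
    show "(\<lambda>a. {..<n} - {a}) ` x_lines n F \<subseteq> fst ` A"
      by (force simp: x_lines_def A_def)
  qed (use fin in \<open>auto simp: A_def\<close>)
  also have "\<dots> \<le> card A" using fin by (intro card_image_le) (auto simp: A_def)
  finally have a: "card (x_lines n F) \<le> card A" .
  have "card (x_lines n (prod.swap ` F)) = card ((\<lambda>a. {..<n} - {a}) ` x_lines n (prod.swap ` F))"
    by (rule card_image[symmetric]) (rule inj_onI, simp add: x_lines_def inj)
  also have "\<dots> \<le> card (snd ` B)"
  proof (rule card_mono)
    show "(\<lambda>a. {..<n} - {a}) ` x_lines n (prod.swap ` F) \<subseteq> snd ` B"
      by (force simp: x_lines_def B_def)
  qed (use fin in \<open>auto simp: B_def\<close>)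
  also have "\<dots> \<le> card B" using fin by (intro card_image_le) (auto simp: B_def)
  finally have b: "card (x_lines n (prod.swap ` F)) \<le> card B" .
  have "card (z_lines n F) \<le> card C"
  proof (rule card_inj_on_le)
    show "inj_on (\<lambda>(a, b). ({..<n} - {a}, {..<n} - {b})) (z_lines n F)"
      unfolding z_lines_def by (intro inj_onI) (auto simp only: split_paired_all mem_Collect_eq prod.case prod.inject intro: inj)
    show "(\<lambda>(a, b). ({..<n} - {a}, {..<n} - {b})) ` z_lines n F \<subseteq> C"
      by (auto simp: z_lines_def C_def)
  qed (use fin in \<open>auto simp: C_def\<close>)
  moreover have "card (A \<union> B \<union> C) = card A + card B + card C"
    using fin n by (subst card_Un_disjoint; (subst card_Un_disjoint)?) (auto simp: A_def B_def C_def)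
  moreover have "card (A \<union> B \<union> C) \<le> card F"
    using fin by (intro card_mono) (auto simp: A_def B_def C_def)
  ultimately show ?thesis using a b by linarith
qed

section \<open>The lower bound, with \<open>n = 2\<close> treated separately\<close>

lemma card_patterns_2: "card (patterns 2) = 8"
proof -
  have "patterns 2 = (Pow {..<2} - {{..<2}}) \<times> (Pow {..<2} - {{..<2}}) - {({}, {})}"
    by (auto simp: patterns_iff)
  moreover have "card (Pow {..<2 :: nat} - {{..<2}}) = 3" by (simp add: card_Diff_subset card_Pow)
  moreover have "({}, {}) \<in> (Pow {..<2 :: nat} - {{..<2}}) \<times> (Pow {..<2 :: nat} - {{..<2}})"
  proof -
    have "0 \<in> {..<2 :: nat}" by simp
    then show ?thesis by blast
  qed
  ultimately show ?thesis by (simp add: card_cartesian_product)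
qed

text \<open>For \<open>n = 2\<close> every pattern has a single nonzero row or column, so
  \<open>P\<close> lies in \<open>F\<close>. One probe has only three possible values, too few for
  the at least seven patterns outside \<open>F\<close>.\<close>

lemma card_separating_2:
  assumes sep: "separating 2 F P"
  shows "card F \<ge> 2"
proof (rule ccontr)
  assume "\<not> card F \<ge> 2"
  have F: "F \<subseteq> patterns 2" using sep by (simp add: separating_def)
  then have fin: "finite F" using finite_patterns finite_subset by blast
  have "P \<subseteq> F"
  proof
    fix e assume e: "e \<in> P"
    then have "e \<in> patterns 2" using sep unfolding separating_def by blast
    then have ep: "fst e \<subset> {..<2}" "snd e \<subset> {..<2}" "e \<noteq> ({}, {})"
      by (simp_all add: patterns_iff)
    then have "card (fst e) < 2" "card (snd e) < 2"
      using psubset_card_mono[OF finite_lessThan, of _ 2] by auto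
    moreover have "card (fst e) \<noteq> 0 \<or> card (snd e) \<noteq> 0"
      using ep finite_subset[of _ "{..<2 :: nat}"] by (auto simp: prod_eq_iff)
    ultimately have "card (fst e) = 2 - 1 \<or> card (snd e) = 2 - 1" by linarith
    then show "e \<in> F" using sep e unfolding separating_def by blast
  qed
  have "card F \<le> Suc 0" using \<open>\<not> card F \<ge> 2\<close> by simp
  then have eq: "d = e" if "d \<in> P" "e \<in> P" for d e
    using fin card_le_Suc0_iff_eq[of F] that \<open>P \<subseteq> F\<close> by blast
  \<comment> \<open>This also covers an empty \<open>P\<close>.\<close>
  obtain e where e: "P \<subseteq> {e}" using eq by blast
  have "inj_on (\<lambda>c. pdist 2 c e) (patterns 2 - F)"
  proof (rule inj_onI, rule ccontr)
    fix c d assume "c \<in> patterns 2 - F" "d \<in> patterns 2 - F" "pdist 2 c e = pdist 2 d e" "c \<noteq> d"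
    then show False using sep e unfolding separating_def by blast
  qed
  moreover have "(\<lambda>c. pdist 2 c e) ` (patterns 2 - F) \<subseteq> {1, 2, 3}" by (auto simp: pdist_def)
  ultimately have "card (patterns 2 - F) \<le> card {1, 2, 3 :: nat}" by (rule card_inj_on_le) simp
  then show False using \<open>card F \<le> Suc 0\<close> F fin by (simp add: card_Diff_subset card_patterns_2)
qed

lemma card_separating:
  assumes n: "n \<ge> 2" and sep: "separating n F P"
  shows "2 * (n - 1) \<le> card F"
proof (cases "n = 2")
  case True
  then show ?thesis using card_separating_2 sep by simp
next
  case False
  then have n3: "n \<ge> 3" using n by simp
  let ?F' = "prod.swap ` F"
  \<comment> \<open>The difference of the two sides is (p - 1)(p - 2), never negative for an
    integer; \<open>p = 0\<close>, where subtraction truncates, is checked apart.\<close>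
  have arith: "2 * p \<le> p * (p - 1) + 2" for p :: nat
  proof -
    consider "p = 0" | "p = 1" | q where "p = q + 2"
      by (metis One_nat_def add_2_eq_Suc' not0_implies_Suc)
    then show ?thesis by cases (auto simp: algebra_simps)
  qed
  \<comment> \<open>Transposes of matrix units are matrix units, so both bounds involve the same
    count; adding them gives \<open>p + q\<close> at most that count plus 2.\<close>
  have "z_lines n ?F' = prod.swap ` z_lines n F"
    by (force simp: z_lines_def)
  then have z': "card (z_lines n ?F') = card (z_lines n F)" by (simp add: card_image)
  have "x_lines n X \<subseteq> {..<n}" for X by (auto simp: x_lines_def)
  then have le: "card (x_lines n X) \<le> n" for X using card_mono[of "{..<n}"] by simp
  define p where "p = n - card (x_lines n F)"
  define q where "q = n - card (x_lines n ?F')"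
  have "2 * p \<le> card (z_lines n F) + 2"
    using card_z_lines[OF n3 sep] arith[of p] by (simp add: p_def)
  moreover have "2 * q \<le> card (z_lines n F) + 2"
    using card_z_lines[OF n3 separating_swap[OF sep]] arith[of q] by (simp add: q_def z')
  moreover have "card (x_lines n F) = n - p" "card (x_lines n ?F') = n - q" "p \<le> n" "q \<le> n"
    using le by (auto simp: p_def q_def)
  moreover have "card (x_lines n F) + card (x_lines n ?F') + card (z_lines n F) \<le> card F"
    using card_lines_le[OF n] sep by (simp add: separating_def)
  ultimately show ?thesis by linarith
qed

text \<open>The vertices outside \<open>W\<close> have distinct patterns, and these are exactly the
  patterns outside \<open>F\<close>. So the size of \<open>W\<close> is governed by
  \<open>card F\<close>, which \<open>card_separating\<close> bounds from below.\<close>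

lemma card_resolving_set_ge:
  assumes n: "n \<ge> 2" and W: "resolving_set (zdg n) W"
  shows "card (zdg_basis n) \<le> card W"
proof -
  let ?V = "pverts (zdg n)"
  have sub: "W \<subseteq> ?V" using W unfolding resolving_set_zdg_iff by blast
  have sep: "\<exists>w \<in> W. pdist n (pattern u) (pattern w) \<noteq> pdist n (pattern v) (pattern w)"
    if "u \<in> ?V - W" "v \<in> ?V - W" "u \<noteq> v" for u v
    using W that unfolding resolving_set_zdg_iff by blast+
  define F where "F = {c \<in> patterns n. pattern_class n c \<subseteq> W}"
  have FK: "F \<subseteq> patterns n" by (auto simp: F_def)
  have inj: "inj_on pattern (?V - W)"
    by (rule inj_onI, rule ccontr) (use sep in fastforce)
  have img: "pattern ` (?V - W) = patterns n - F"
  proof -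
    have "pattern A \<in> patterns n" if "A \<in> ?V" for A using that by (simp add: pverts_zdg)
    then show ?thesis unfolding F_def pattern_class_def by blast
  qed
  have "separating n F (pattern ` W)"
    unfolding separating_def
  proof (intro conjI ballI impI)
    show "F \<subseteq> patterns n" by (rule FK)
    show "pattern ` W \<subseteq> patterns n" using sub by (auto simp: pverts_zdg)
  next
    fix e assume "e \<in> pattern ` W" and e: "card (fst e) = n - 1 \<or> card (snd e) = n - 1"
    then obtain w where w: "w \<in> W" "pattern w = e" by blast
    then have "w \<in> pattern_class n e" "e \<in> patterns n" using sub by (auto simp: pattern_class_def pverts_zdg)
    \<comment> \<open>A pattern with a single nonzero row or column has only one matrix, so meeting
      \<open>W\<close> puts its whole class into \<open>W\<close>.\<close>
    moreover from this have "A = w" if "A \<in> pattern_class n e" for A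
      using pattern_class_unique[OF that _ _ e] n by simp
    then have "pattern_class n e \<subseteq> {w}" by blast
    ultimately show "e \<in> F" using w(1) unfolding F_def by blast
  next
    fix c d assume cd: "c \<in> patterns n - F" "d \<in> patterns n - F" "c \<noteq> d"
    then obtain u v where "u \<in> ?V - W" "pattern u = c" "v \<in> ?V - W" "pattern v = d"
      unfolding img[symmetric] by blast
    moreover from this cd have "u \<noteq> v" by blast
    ultimately show "\<exists>e\<in>pattern ` W. pdist n c e \<noteq> pdist n d e" using sep by blast
  qed
  then have F: "2 * (n - 1) \<le> card F" by (rule card_separating[OF n])
  have "card (?V - W) = card (patterns n - F)"
    using card_image[OF inj] img by simp
  moreover have "card (?V - W) = card ?V - card W"
    using sub finite_pverts_zdg finite_subset by (intro card_Diff_subset) blast+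
  moreover have "card W \<le> card ?V" using sub finite_pverts_zdg by (rule card_mono[rotated])
  moreover have "card (patterns n - F) = card (patterns n) - card F"
    using FK finite_patterns finite_subset by (intro card_Diff_subset) blast+
  moreover have "card F \<le> card (patterns n)" using FK finite_patterns by (rule card_mono[rotated])
  ultimately have "card ?V + card F = card (patterns n) + card W" by linarith
  then have "int (card ?V) + int (card F) = int (card (patterns n)) + int (card W)"
    by (simp flip: of_nat_add)
  moreover have "int (2 * (n - 1)) \<le> int (card F)" using F by (simp only: of_nat_le_iff)
  then have "2 * (int n - 1) \<le> int (card F)" using n by (simp add: of_nat_diff)
  ultimately have "int (card (zdg_basis n)) \<le> int (card W)"
    unfolding card_zdg_basis[OF n] by linarith
  then show ?thesis by simp
qed

theorem theorem3p11:
  fixes n :: nat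
  assumes "n \<ge> 2"
  shows "int (metric_dimension (zero_divisor_graph (boolean_matrices n))) =
    2 * (int n - 1) +
    (\<Sum>(i, j) \<in> ({0..n - 2} \<times> {0..n - 2}) - {(0, 0)}.
      int (n choose i) * int (n choose j) *
      ((\<Sum>k = 0..n - j. (-1) ^ k * int ((n - j) choose k) * (2 ^ (n - j - k) - 1) ^ (n - i)) - 1))"
proof -
  have "metric_dimension (zdg n) = card (zdg_basis n)"
    unfolding metric_dimension_def
    using resolving_zdg_basis[OF assms] card_resolving_set_ge[OF assms]
    by (intro cInf_eq_minimum) auto
  then show ?thesis
    using card_zdg_basis[OF assms] card_pverts_minus_patterns[OF assms] by simp
qed

end
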